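(* Let $a$ and $d$ be positive integers with $0\leq a\leq d$. Let $G$ be a bipartite $d$-regular graph on $n$ vertices. There exists a probability distribution on the set of pairs $(H,M)$, where $H$ is an $a$-factor of $G$ and $M$ is an $n\times n$ real matrix with $\|M\|\leq 6\sqrt d$, such that, for any vectors $u,v\in\mathbb{R}^n$ and any real $t\geq 0$, $$\Pr\left[\left|u^\intercal\left(A_H-\frac adA_G+M\right)v\right|>t(2+\sqrt 2)\sqrt{dn\lceil\log_2 n\rceil}\,\|u\|_\infty\|v\|_\infty\right]\leq 2(\log_2 d)e^{-t^2/2}.$$
   Context: Graphs are finite and simple. $A_G$ is the adjacency matrix of $G$, and $\|M\|$ is the spectral (operator $\ell^2$) norm. An $a$-factor of a $d$-regular graph $G$ is an $a$-regular subgraph of $G$ on the full vertex set $V(G)$; $A_H$ is indexed by $V(G)$, identified with $\{1,\dots,n\}$. *)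

theory Defs
  imports "HOL-Probability.Probability"
begin

text \<open>
  A finite simple graph whose vertex set is the whole finite type \<open>'n\<close> is given by its
  adjacency relation, so each undirected edge occurs as two ordered pairs. The type \<open>'n\<close>
  plays the role of \<open>{1, \<dots>, n}\<close> with \<open>n = CARD('n)\<close>; all graphs on it are spanning.
\<close>

type_synonym 'n graph = "('n \<times> 'n) set"

definition simple_graph :: "'n graph \<Rightarrow> bool" where
  "simple_graph G \<longleftrightarrow> sym G \<and> irrefl G"

definition bipartite :: "'n graph \<Rightarrow> bool" where
  "bipartite G \<longleftrightarrow> (\<exists>X. \<forall>(x, y) \<in> G. x \<in> X \<longleftrightarrow> y \<notin> X)"

definition vertex_degree :: "'n graph \<Rightarrow> 'n \<Rightarrow> nat" where
  "vertex_degree G x = card {y. (x, y) \<in> G}"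

definition regular :: "nat \<Rightarrow> 'n graph \<Rightarrow> bool" where
  "regular d G \<longleftrightarrow> (\<forall>x. vertex_degree G x = d)"

definition factors :: "nat \<Rightarrow> 'n graph \<Rightarrow> 'n graph set" where
  "factors a G = {H. simple_graph H \<and> H \<subseteq> G \<and> regular a H}"

definition adj_matrix :: "'n::finite graph \<Rightarrow> real ^ 'n ^ 'n" where
  "adj_matrix G = (\<chi> i j. if (i, j) \<in> G then 1 else 0)"

definition spectral_norm :: "real ^ 'n ^ 'n \<Rightarrow> real" where
  "spectral_norm M = onorm (\<lambda>x. M *v x)"

text \<open>
  The set of pairs \<open>(H, M)\<close> with \<open>H\<close> an \<open>a\<close>-factor of \<open>G\<close> and \<open>M\<close> of spectral norm at most
  \<open>r\<close>, with the discrete \<open>\<sigma>\<close>-algebra on the (finitely many) factors and the Borel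
  \<open>\<sigma>\<close>-algebra on the matrices. Only its measurable structure is used; fixing it keeps
  the events of interest measurable (\<^const>\<open>measure\<close> is 0 on non-measurable sets).
\<close>

definition factor_matrix_space ::
    "nat \<Rightarrow> 'n::finite graph \<Rightarrow> real \<Rightarrow> ('n graph \<times> (real ^ 'n ^ 'n)) measure" where
  "factor_matrix_space a G r =
     count_space (factors a G) \<Otimes>\<^sub>M restrict_space borel {M. spectral_norm M \<le> r}"

lemma space_factor_matrix_space:
  "space (factor_matrix_space a G r) = factors a G \<times> {M. spectral_norm M \<le> r}"
  by (simp add: factor_matrix_space_def space_pair_measure space_restrict_space)

lemma bilinear_event_measurable:
  fixes u v :: "real ^ 'n::finite"
  assumes "sets N = sets (factor_matrix_space a G r)"
  shows "{x \<in> space N. case x of (H, M) \<Rightarrow>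
      \<bar>u \<bullet> ((adj_matrix H - c *\<^sub>R adj_matrix G + M) *v v)\<bar> > s} \<in> sets N"
proof -
  let ?C = "count_space (factors a G)"
  let ?B = "restrict_space (borel :: (real ^ 'n ^ 'n) measure) {M. spectral_norm M \<le> r}"
  have sp: "space N = space (factor_matrix_space a G r)"
    using assms by (rule sets_eq_imp_space_eq)
  have fst: "(\<lambda>x. adj_matrix (fst x)) \<in> borel_measurable (?C \<Otimes>\<^sub>M ?B)"
    by (rule measurable_compose[OF measurable_fst]) simp
  have snd: "snd \<in> borel_measurable (?C \<Otimes>\<^sub>M ?B)"
    by (rule measurable_compose[OF measurable_snd, where g = "\<lambda>x. x", simplified])
       (simp add: measurable_restrict_space1)
  have "continuous_on UNIV (\<lambda>A :: real ^ 'n ^ 'n. u \<bullet> (A *v v))"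
    unfolding matrix_vector_mult_def by (intro continuous_intros)
  then have lin: "(\<lambda>A :: real ^ 'n ^ 'n. u \<bullet> (A *v v)) \<in> borel_measurable borel"
    by (rule borel_measurable_continuous_onI)
  have meas: "(\<lambda>x. u \<bullet> ((adj_matrix (fst x) - c *\<^sub>R adj_matrix G + snd x) *v v))
      \<in> borel_measurable (?C \<Otimes>\<^sub>M ?B)"
    by (rule measurable_compose[OF _ lin]) (use fst snd in measurable)
  have "{x \<in> space (?C \<Otimes>\<^sub>M ?B).
      s < \<bar>u \<bullet> ((adj_matrix (fst x) - c *\<^sub>R adj_matrix G + snd x) *v v)\<bar>} \<in> sets (?C \<Otimes>\<^sub>M ?B)"
    using meas by measurable
  then show ?thesis
    using assms sp by (simp add: factor_matrix_space_def case_prod_beta)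
qed

end

theory Submission
  imports Defs
begin

text \<open>
  Let \<open>k = \<lceil>log\<^sub>2 n\<rceil>\<close>. To halve an even degree \<open>d\<close>, remove edge-disjoint cycles of length at most
  \<open>2k\<close> greedily and sign each of them alternately, starting with an independent fair sign.
  Bipartiteness makes the signs sum to zero at every vertex, so the positive edges are half of the
  edges at each vertex, and the bilinear form of the signed matrix is a Rademacher sum with variance
  proxy \<open>O(d n k)\<close>. What remains has no cycle of length at most \<open>2k\<close>, so its balls of radius
  \<open>k\<close> are trees and its adjacency matrix \<open>A\<close> satisfies \<open>\<parallel>A\<^sup>k e\<^sub>i\<parallel> \<le> (2\<surd>d)\<^sup>k\<close>; since \<open>n \<le> 2\<^sup>k\<close>, this
  gives \<open>\<parallel>A\<parallel> \<le> \<surd>(8d)\<close>. The remainder is split deterministically and its contribution is absorbed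
  by \<open>M\<close>. An odd degree is first made even by deleting a perfect matching. Halving is iterated,
  passing to the complementary factor whenever \<open>2a > d\<close>.
\<close>

section \<open>Short cycles as balanced sign patterns\<close>

text \<open>Cut the walk at its first repetition \<open>w a = w b\<close>. The piece in between is
  injective, and irreflexivity with non-backtracking forces length at least 3. Rotating this piece
  and fixing all other vertices is a permutation containing a genuine cycle.\<close>

lemma closed_walk_perm:
  fixes w :: "nat \<Rightarrow> 'n::finite"
  assumes R: "irrefl R"
    and walk: "\<And>s. s < m \<Longrightarrow> (w s, w (Suc s)) \<in> R"
    and nonback: "\<And>s. s + 2 \<le> m \<Longrightarrow> w (s + 2) \<noteq> w s"
    and closed: "\<not> inj_on w {..m}"
  obtains \<sigma> where "bij \<sigma>" "\<And>x. \<sigma> x \<noteq> x \<Longrightarrow> (x, \<sigma> x) \<in> R"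
    "card {x. \<sigma> x \<noteq> x} \<le> m" "\<exists>x. \<sigma> (\<sigma> x) \<noteq> x"
proof -
  \<comment> \<open>Minimality of \<open>b\<close> is what makes \<open>w\<close> injective on the
    indices below \<open>b\<close>.\<close>
  define b where "b = (LEAST b. \<exists>a<b. w a = w b)"
  have "\<exists>b\<le>m. \<exists>a<b. w a = w b"
    using closed unfolding inj_on_def by (metis atMost_iff linorder_neqE_nat)
  then obtain b' where b': "b' \<le> m" "\<exists>a<b'. w a = w b'" by blast
  have "\<exists>a<b. w a = w b" and "b \<le> b'"
    using b'(2) unfolding b_def by (rule LeastI, rule Least_le)
  with b' obtain a where a: "a < b" "w a = w b" and bm: "b \<le> m" by auto
  have min: "w s \<noteq> w s'" if "s < s'" "s' < b" for s s'
    using not_less_Least[of s' "\<lambda>b. \<exists>a<b. w a = w b"] that unfolding b_def by blast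
  have inj: "s = s'" if "w s = w s'" "s < b" "s' < b" for s s'
    using min[of s s'] min[of s' s] that by (metis linorder_neqE_nat)
  have "b \<noteq> Suc a" using walk[of a] R a bm by (auto simp: irrefl_def)
  moreover have "b \<noteq> a + 2" using nonback[of a] a bm by auto
  ultimately have ab: "a + 3 \<le> b" using a by linarith
  define C where "C = w ` {a..<b}"
  define ix where "ix x = (THE s. s \<in> {a..<b} \<and> w s = x)" for x
  have ix: "ix (w s) = s" if "a \<le> s" "s < b" for s
    unfolding ix_def using that inj by (intro the_equality) auto
  define \<sigma> where "\<sigma> x = (if x \<in> C then w (Suc (ix x)) else x)" for x
  have \<sigma>w: "\<sigma> (w s) = w (Suc s)" if "a \<le> s" "s < b" for s
    using that ix[OF that] unfolding \<sigma>_def C_def by auto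
  have supp: "x \<in> C" if "\<sigma> x \<noteq> x" for x
    using that unfolding \<sigma>_def by presburger
  have "\<exists>y. x = \<sigma> y" for x
  proof (cases "x \<in> C")
    case True
    then obtain s where s: "x = w s" "a \<le> s" "s < b" unfolding C_def by auto
    show ?thesis
    proof (cases "s = a")
      case True
      \<comment> \<open>The rotation wraps around: \<open>w (b - 1)\<close> is mapped to
        \<open>w b\<close>, which equals \<open>w a\<close>.\<close>
      then show ?thesis using s a \<sigma>w[of "b - 1"] ab by (intro exI[of _ "w (b - 1)"]) auto
    next
      case False
      then show ?thesis using s \<sigma>w[of "s - 1"] by (intro exI[of _ "w (s - 1)"]) auto
    qed
  qed (auto simp: \<sigma>_def intro: exI[of _ x])
  then have "bij \<sigma>"
    by (simp add: surj_def finite_UNIV_surj_inj bij_def)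
  moreover have "(x, \<sigma> x) \<in> R" if "\<sigma> x \<noteq> x" for x
    using supp[OF that] \<sigma>w walk bm unfolding C_def by (auto simp: le_trans)
  moreover have "card {x. \<sigma> x \<noteq> x} \<le> m"
  proof -
    have "card {x. \<sigma> x \<noteq> x} \<le> card C" using supp by (intro card_mono) auto
    also have "\<dots> \<le> b - a" unfolding C_def using card_image_le[of "{a..<b}" w] by simp
    finally show ?thesis using bm by simp
  qed
  moreover have "\<sigma> (\<sigma> (w a)) \<noteq> w a"
    using \<sigma>w[of a] \<sigma>w[of "Suc a"] min[of a "Suc (Suc a)"] ab by auto
  ultimately show ?thesis using that by blast
qed

section \<open>Signed circulations from permutations\<close>

definition side_sign :: "'n set \<Rightarrow> 'n \<Rightarrow> real" where
  "side_sign X x = (if x \<in> X then 1 else - 1)"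

text \<open>
  A permutation that moves vertices along edges encodes disjoint cycles. An edge gets sign \<open>1\<close> if it
  is traversed starting in \<open>X\<close> and \<open>- 1\<close> otherwise, so signs alternate along each cycle; fixed points
  and 2-cycles cancel out.
\<close>

definition perm_sign :: "'n set \<Rightarrow> ('n \<Rightarrow> 'n) \<Rightarrow> 'n \<Rightarrow> 'n \<Rightarrow> real" where
  "perm_sign X \<sigma> x y = side_sign X x * (of_bool (y = \<sigma> x) - of_bool (x = \<sigma> y))"

text \<open>These are the perturbations that keep a matrix symmetric and preserve its row sums; in
  graph terms, they preserve degrees.\<close>

definition circulation :: "'n::finite graph \<Rightarrow> ('n \<Rightarrow> 'n \<Rightarrow> real) \<Rightarrow> bool" where
  "circulation R B \<longleftrightarrow> (\<forall>x y. B x y = B y x) \<and> (\<forall>x y. B x y \<in> {- 1, 0, 1}) \<and>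
     (\<forall>x. (\<Sum>y\<in>UNIV. B x y) = 0) \<and> (\<forall>x y. B x y \<noteq> 0 \<longrightarrow> (x, y) \<in> R)"

definition support :: "('n \<Rightarrow> 'n \<Rightarrow> real) \<Rightarrow> ('n \<times> 'n) set" where
  "support B = {(x, y). B x y \<noteq> 0}"

text \<open>The side \<open>X\<close> is a parameter rather than existentially bound, so that all
  subgraphs share one bipartition.\<close>

locale bipartite_graph =
  fixes X :: "'n::finite set" and R :: "'n graph"
  assumes sym: "sym R"
    and bip: "\<And>x y. (x, y) \<in> R \<Longrightarrow> x \<in> X \<longleftrightarrow> y \<notin> X"
begin

lemma irr: "irrefl R"
  using bip unfolding irrefl_def by blast

lemma symE: "(x, y) \<in> R \<longleftrightarrow> (y, x) \<in> R"
  using sym by (meson symD)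

lemma subgraph: "F \<subseteq> R \<Longrightarrow> sym F \<Longrightarrow> bipartite_graph X F"
  by unfold_locales (use bip in auto)

context
  fixes \<sigma> :: "'n \<Rightarrow> 'n"
  assumes bij: "bij \<sigma>" and edge: "\<And>x. \<sigma> x \<noteq> x \<Longrightarrow> (x, \<sigma> x) \<in> R"
begin

lemma perm_sign_supp:
  assumes "perm_sign X \<sigma> x y \<noteq> 0"
  shows "(x, y) \<in> R"
proof -
  have "y = \<sigma> x \<and> y \<noteq> x \<or> x = \<sigma> y \<and> y \<noteq> x"
    using assms by (auto simp: perm_sign_def of_bool_def split: if_splits)
  then show ?thesis using edge symE by metis
qed

text \<open>Bipartiteness enters here: exchanging the endpoints of an edge negates both the side
  sign and the difference of indicators. Off \<open>R\<close> both values vanish.\<close>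

lemma perm_sign_sym: "perm_sign X \<sigma> x y = perm_sign X \<sigma> y x"
proof (cases "(x, y) \<in> R")
  case True
  then show ?thesis using bip[OF True] by (auto simp: perm_sign_def side_sign_def)
next
  case False
  then show ?thesis using perm_sign_supp[of x y] perm_sign_supp[of y x] symE by metis
qed

lemma perm_sign_values: "perm_sign X \<sigma> x y \<in> {- 1, 0, 1}"
  by (auto simp: perm_sign_def side_sign_def)

text \<open>Every vertex has exactly one successor and one predecessor under a bijection, so the two
  indicators have equal sums.\<close>

lemma perm_sign_sum: "(\<Sum>y\<in>UNIV. perm_sign X \<sigma> x y) = 0"
proof -
  have "(\<Sum>y\<in>UNIV. of_bool (x = \<sigma> y) :: real) = (\<Sum>y\<in>UNIV. of_bool (x = y))"
    using sum.reindex_bij_betw[OF bij, of "\<lambda>y. of_bool (x = y) :: real"] by simp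
  then show ?thesis
    by (simp add: perm_sign_def sum_distrib_left[symmetric] sum_subtractf)
qed

lemma circulation_perm_sign: "circulation R (perm_sign X \<sigma>)"
  unfolding circulation_def
  using perm_sign_sym perm_sign_values perm_sign_sum perm_sign_supp by blast

lemma support_perm_sign_nonempty:
  assumes "\<exists>x. \<sigma> (\<sigma> x) \<noteq> x"
  shows "support (perm_sign X \<sigma>) \<noteq> {}"
proof -
  from assms obtain x where "\<sigma> (\<sigma> x) \<noteq> x" by blast
  then have "perm_sign X \<sigma> x (\<sigma> x) \<noteq> 0" by (auto simp: perm_sign_def side_sign_def)
  then show ?thesis by (auto simp: support_def)
qed

lemma card_support_perm_sign: "card (support (perm_sign X \<sigma>)) \<le> 2 * card {x. \<sigma> x \<noteq> x}"
proof -
  let ?C = "{x. \<sigma> x \<noteq> x}"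
  have "support (perm_sign X \<sigma>) \<subseteq> (\<lambda>x. (x, \<sigma> x)) ` ?C \<union> (\<lambda>x. (\<sigma> x, x)) ` ?C"
  proof (intro subsetI, safe)
    fix x y assume "(x, y) \<in> support (perm_sign X \<sigma>)" "(x, y) \<notin> (\<lambda>x. (\<sigma> x, x)) ` ?C"
    then show "(x, y) \<in> (\<lambda>x. (x, \<sigma> x)) ` ?C"
      by (auto simp: support_def perm_sign_def image_iff of_bool_def split: if_splits)
  qed
  then have "card (support (perm_sign X \<sigma>)) \<le> card ((\<lambda>x. (x, \<sigma> x)) ` ?C \<union> (\<lambda>x. (\<sigma> x, x)) ` ?C)"
    by (intro card_mono) auto
  also have "\<dots> \<le> card ((\<lambda>x. (x, \<sigma> x)) ` ?C) + card ((\<lambda>x. (\<sigma> x, x)) ` ?C)" by (rule card_Un_le)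
  also have "\<dots> \<le> card ?C + card ?C" by (intro add_mono card_image_le) auto
  finally show ?thesis by simp
qed

end

lemma walk_circulation:
  assumes "\<And>s. s < m \<Longrightarrow> (w s, w (Suc s)) \<in> R" "\<And>s. s + 2 \<le> m \<Longrightarrow> w (s + 2) \<noteq> w s"
    and "\<not> inj_on w {..m}"
  obtains B where "circulation R B" "support B \<noteq> {}" "card (support B) \<le> 2 * m"
proof -
  obtain \<sigma> where s: "bij \<sigma>" "\<And>x. \<sigma> x \<noteq> x \<Longrightarrow> (x, \<sigma> x) \<in> R"
    "card {x. \<sigma> x \<noteq> x} \<le> m" "\<exists>x. \<sigma> (\<sigma> x) \<noteq> x"
    by (rule closed_walk_perm[OF irr, of m w]) (use assms in auto)
  show ?thesis
  proof (rule that[of "perm_sign X \<sigma>"])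
    show "circulation R (perm_sign X \<sigma>)" by (rule circulation_perm_sign[OF s(1,2)])
    show "support (perm_sign X \<sigma>) \<noteq> {}" by (rule support_perm_sign_nonempty[OF s(1,2,4)])
    show "card (support (perm_sign X \<sigma>)) \<le> 2 * m"
      using card_support_perm_sign[OF s(1,2)] s(3) by simp
  qed
qed

text \<open>A walk that never turns back can be continued forever, and by the pigeonhole principle
  it repeats a vertex within \<open>CARD('n)\<close> steps.\<close>

lemma min_degree_two_circulation:
  assumes "R \<noteq> {}" and next_edge: "\<And>x y. (x, y) \<in> R \<Longrightarrow> \<exists>z. z \<noteq> y \<and> (x, z) \<in> R"
  obtains B where "circulation R B" "support B \<noteq> {}"
proof -
  \<comment> \<open>The walk is chosen as a sequence of directed edges, so that not turning back is
    a condition on consecutive terms only.\<close>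
  have "\<exists>f. \<forall>n. f n \<in> R \<and> (fst (f (Suc n)) = snd (f n) \<and> snd (f (Suc n)) \<noteq> fst (f n))"
  proof (rule dependent_nat_choice)
    fix e and n :: nat assume e: "e \<in> R"
    then have "(snd e, fst e) \<in> R" using symE by simp
    from next_edge[OF this] show "\<exists>e'. e' \<in> R \<and> fst e' = snd e \<and> snd e' \<noteq> fst e" by auto
  qed (use \<open>R \<noteq> {}\<close> in auto)
  then obtain f where f: "\<And>n. f n \<in> R" "\<And>n. fst (f (Suc n)) = snd (f n)"
    "\<And>n. snd (f (Suc n)) \<noteq> fst (f n)" by blast
  let ?w = "\<lambda>n. fst (f n)" and ?m = "CARD('n)"
  have "\<not> inj_on ?w {..?m}"
  proof
    assume "inj_on ?w {..?m}"
    then have "card {..?m} \<le> CARD('n)" by (intro card_inj_on_le) auto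
    then show False by simp
  qed
  moreover have "(?w s, ?w (Suc s)) \<in> R" for s using f(1)[of s] f(2)[of s] by simp
  moreover have "?w (s + 2) \<noteq> ?w s" for s
    using f(2)[of "Suc s"] f(3)[of s] by simp
  ultimately show ?thesis
    by - (rule walk_circulation[of ?m ?w], assumption+, rule that)
qed

text \<open>
  Push \<open>f\<close> along a circulation supported on its fractional entries until one of them becomes integral.
\<close>

lemma integral_rounding:
  fixes f :: "'n \<Rightarrow> 'n \<Rightarrow> real"
  assumes "\<And>x y. f x y = f y x" "\<And>x y. 0 \<le> f x y" "\<And>x y. f x y \<le> 1"
    and "\<And>x y. (x, y) \<notin> R \<Longrightarrow> f x y = 0" and "\<And>x. (\<Sum>y\<in>UNIV. f x y) \<in> \<int>"
  shows "\<exists>H\<subseteq>R. sym H \<and> (\<forall>x. real (vertex_degree H x) = (\<Sum>y\<in>UNIV. f x y))"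
  using assms
proof (induction "card {(x, y). f x y \<notin> \<int>}" arbitrary: f rule: less_induct)
  case less
  define F where "F = {(x, y). f x y \<notin> \<int>}"
  show ?case
  proof (cases "F = {}")
    case True
    define H where "H = {(x, y). f x y = 1}"
    have f01: "f x y = of_bool ((x, y) \<in> H)" for x y
    proof -
      have "f x y \<in> \<int>" using True by (auto simp: F_def)
      then obtain i where i: "f x y = of_int i" by (auto elim: Ints_cases)
      with less.prems(2,3)[of x y] have "i = 0 \<or> i = 1" by auto
      then show ?thesis using i by (auto simp: H_def)
    qed
    have "real (vertex_degree H x) = (\<Sum>y\<in>UNIV. f x y)" for x
      unfolding f01 vertex_degree_def by (simp add: sum.If_cases of_bool_def)
    moreover have "H \<subseteq> R" using less.prems(4) by (force simp: H_def)
    moreover have "sym H" using less.prems(1) by (auto simp: H_def sym_def)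
    ultimately show ?thesis by blast
  next
    case False
    have "F \<subseteq> R" using less.prems(4) by (force simp: F_def)
    moreover have "sym F" using less.prems(1) by (auto simp: F_def sym_def)
    ultimately interpret F: bipartite_graph X F by (rule subgraph)
    \<comment> \<open>A single fractional entry in a row would make the row sum fractional, so the
      fractional entries form a graph without vertices of degree one.\<close>
    have "\<exists>z. z \<noteq> y \<and> (x, z) \<in> F" if "(x, y) \<in> F" for x y
    proof (rule ccontr)
      assume "\<nexists>z. z \<noteq> y \<and> (x, z) \<in> F"
      then have "(\<Sum>z\<in>UNIV - {y}. f x z) \<in> \<int>" by (intro Ints_sum) (auto simp: F_def)
      moreover have "(\<Sum>z\<in>UNIV. f x z) = f x y + (\<Sum>z\<in>UNIV - {y}. f x z)"
        by (simp add: sum.remove)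
      ultimately have "f x y \<in> \<int>" using less.prems(5)[of x] by (metis Ints_diff add_diff_cancel_right')
      then show False using that by (simp add: F_def)
    qed
    with F.min_degree_two_circulation False obtain B where B: "circulation F B" "support B \<noteq> {}" by blast
    \<comment> \<open>The slack is the distance that an entry can move in the direction of
      \<open>B\<close> before reaching 0 or 1. Moving by the least slack \<open>l\<close> stays
      within the unit interval and makes the minimizing entry integral.\<close>
    define slack where "slack e = (case e of (x, y) \<Rightarrow> if B x y = 1 then 1 - f x y else f x y)" for e
    define l where "l = Min (slack ` support B)"
    have "l \<in> slack ` support B" unfolding l_def using B(2) by (intro Min_in) auto
    then obtain x0 y0 where xy0: "(x0, y0) \<in> support B" "l = slack (x0, y0)" by auto
    have l_le: "l \<le> slack e" if "e \<in> support B" for e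
      unfolding l_def using that by (intro Min_le) auto
    have pos: "slack e > 0" if "e \<in> support B" for e
    proof -
      obtain x y where e: "e = (x, y)" by fastforce
      have "(x, y) \<in> F" using that B(1) by (auto simp: e support_def circulation_def)
      then have "f x y \<noteq> 0" "f x y \<noteq> 1" by (auto simp: F_def)
      then show ?thesis using less.prems(2,3)[of x y] by (auto simp: slack_def e less_le)
    qed
    have l0: "l > 0" using xy0 pos by simp
    define g where "g x y = f x y + l * B x y" for x y
    have Bval: "B x y = - 1 \<or> B x y = 0 \<or> B x y = 1" for x y
      using B(1) by (auto simp: circulation_def)
    have g01: "0 \<le> g x y \<and> g x y \<le> 1" for x y
    proof (cases "B x y = 0")
      case False
      then have "l \<le> slack (x, y)" by (intro l_le) (auto simp: support_def)
      then show ?thesis using Bval[of x y] False l0 less.prems(2,3)[of x y]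
        by (auto simp: g_def slack_def split: if_splits)
    qed (use less.prems(2,3) in \<open>auto simp: g_def\<close>)
    have Bsum: "(\<Sum>y\<in>UNIV. B x y) = 0" for x using B(1) by (auto simp: circulation_def)
    have gsum: "(\<Sum>y\<in>UNIV. g x y) = (\<Sum>y\<in>UNIV. f x y)" for x
      by (simp add: g_def sum.distrib sum_distrib_left[symmetric] Bsum)
    have BF: "B x y = 0" if "(x, y) \<notin> F" for x y using B(1) that by (auto simp: circulation_def)
    have "g x0 y0 \<in> \<int>"
      using xy0 Bval[of x0 y0] by (auto simp: g_def slack_def support_def split: if_splits)
    moreover have "(x0, y0) \<in> F" using xy0 BF by (auto simp: support_def)
    moreover have "{(x, y). g x y \<notin> \<int>} \<subseteq> F" using BF by (auto simp: g_def F_def)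
    ultimately have "{(x, y). g x y \<notin> \<int>} \<subset> F" by auto
    then have "card {(x, y). g x y \<notin> \<int>} < card {(x, y). f x y \<notin> \<int>}"
      unfolding F_def by (intro psubset_card_mono) auto
    then have "\<exists>H\<subseteq>R. sym H \<and> (\<forall>x. real (vertex_degree H x) = (\<Sum>y\<in>UNIV. g x y))"
    proof (rule less.hyps)
      show "g x y = g y x" for x y
        using less.prems(1)[of x y] B(1) by (simp add: g_def circulation_def)
      show "g x y = 0" if "(x, y) \<notin> R" for x y
        using less.prems(4)[OF that] BF[of x y] that \<open>F \<subseteq> R\<close> by (auto simp: g_def)
    qed (use g01 gsum less.prems(5) in auto)
    then show ?thesis by (simp add: gsum)
  qed
qed

end

section \<open>Spectral norm of graphs without short cycles\<close>

lemma adj_matrix_mult_nth: "(adj_matrix C *v g) $ x = (\<Sum>y | (x, y) \<in> C. g $ y)"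
proof -
  have "(adj_matrix C *v g) $ x = (\<Sum>y\<in>UNIV. if (x, y) \<in> C then g $ y else 0)"
    unfolding matrix_vector_mult_def adj_matrix_def by (simp add: if_distrib if_distribR cong: if_cong)
  then show ?thesis by (simp add: sum.If_cases)
qed

lemma norm_vec_squared: "(norm (g :: real ^ 'n))\<^sup>2 = (\<Sum>x\<in>UNIV. (g $ x)\<^sup>2)"
  unfolding norm_vec_def L2_set_def by (simp add: sum_nonneg)

text \<open>This is a Schur test: Cauchy-Schwarz in every row costs a factor \<open>r\<close>, and
  after exchanging the sums each column is counted at most \<open>c\<close> times.\<close>

lemma norm_adj_matrix_mult:
  fixes C :: "'n::finite graph"
  assumes row: "\<And>x. card {y. (x, y) \<in> C} \<le> r" and col: "\<And>y. card {x. (x, y) \<in> C} \<le> c"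
  shows "norm (adj_matrix C *v g) \<le> sqrt (real r * real c) * norm g"
proof -
  have "(norm (adj_matrix C *v g))\<^sup>2 = (\<Sum>x\<in>UNIV. (\<Sum>y | (x, y) \<in> C. g $ y)\<^sup>2)"
    by (simp add: norm_vec_squared adj_matrix_mult_nth)
  also have "\<dots> \<le> (\<Sum>x\<in>UNIV. real r * (\<Sum>y | (x, y) \<in> C. (g $ y)\<^sup>2))"
  proof (rule sum_mono)
    fix x
    have "(\<Sum>y | (x, y) \<in> C. g $ y)\<^sup>2 \<le> (\<Sum>y | (x, y) \<in> C. (g $ y)\<^sup>2) * card {y. (x, y) \<in> C}"
      by (rule sum_squared_le_sum_of_squares)
    also have "\<dots> \<le> (\<Sum>y | (x, y) \<in> C. (g $ y)\<^sup>2) * real r"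
      using row[of x] by (intro mult_left_mono) (auto intro: sum_nonneg)
    finally show "(\<Sum>y | (x, y) \<in> C. g $ y)\<^sup>2 \<le> real r * (\<Sum>y | (x, y) \<in> C. (g $ y)\<^sup>2)"
      by (simp add: mult.commute)
  qed
  also have "\<dots> = real r * (\<Sum>x\<in>UNIV. \<Sum>y | (x, y) \<in> C. (g $ y)\<^sup>2)"
    by (simp add: sum_distrib_left)
  also have "(\<Sum>x\<in>UNIV. \<Sum>y | (x, y) \<in> C. (g $ y)\<^sup>2) = (\<Sum>y\<in>UNIV. \<Sum>x | (x, y) \<in> C. (g $ y)\<^sup>2)"
    using sum.swap_restrict[of UNIV UNIV "\<lambda>x y. (g $ y)\<^sup>2" "\<lambda>x y. (x, y) \<in> C"] by simp
  also have "\<dots> = (\<Sum>y\<in>UNIV. real (card {x. (x, y) \<in> C}) * (g $ y)\<^sup>2)"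
    by simp
  also have "\<dots> \<le> (\<Sum>y\<in>UNIV. real c * (g $ y)\<^sup>2)"
    using col by (intro sum_mono mult_right_mono) auto
  also have "\<dots> = real c * (norm g)\<^sup>2" by (simp add: norm_vec_squared sum_distrib_left)
  finally have "(norm (adj_matrix C *v g))\<^sup>2 \<le> real r * (real c * (norm g)\<^sup>2)"
    by (simp add: mult_left_mono)
  also have "\<dots> = (sqrt (real r * real c) * norm g)\<^sup>2" by (simp add: power_mult_distrib)
  finally show ?thesis by (rule power2_le_imp_le) simp
qed

lemma symmetric_matrix_inner:
  fixes S :: "real ^ 'n::finite ^ 'n"
  assumes "\<And>x y. S $ x $ y = S $ y $ x"
  shows "(S *v u) \<bullet> v = u \<bullet> (S *v v)"
proof -
  have "transpose S = S" using assms by (simp add: transpose_def vec_eq_iff)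
  then show ?thesis by (metis dot_lmul_matrix inner_commute vector_transpose_matrix)
qed

text \<open>The norms of the iterates form a log-convex sequence, so their successive ratios
  increase and the first ratio to the power \<open>m\<close> is at most the product of the first
  \<open>m\<close>. The inequality is kept free of division so that vanishing iterates are
  covered.\<close>

lemma norm_symmetric_power:
  fixes S :: "real ^ 'n::finite ^ 'n"
  assumes S: "\<And>x y. S $ x $ y = S $ y $ x"
  shows "norm (S *v x) ^ m * norm x \<le> norm x ^ m * norm (((*v) S ^^ m) x)"
proof -
  define a where "a m = norm (((*v) S ^^ m) x)" for m
  have sq: "(a (Suc m))\<^sup>2 \<le> a m * a (Suc (Suc m))" for m
  proof -
    let ?y = "((*v) S ^^ m) x"
    have "(a (Suc m))\<^sup>2 = (S *v ?y) \<bullet> (S *v ?y)" by (simp add: a_def power2_norm_eq_inner)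
    also have "\<dots> = ?y \<bullet> (S *v (S *v ?y))" by (rule symmetric_matrix_inner[OF S])
    also have "\<dots> \<le> a m * a (Suc (Suc m))"
      unfolding a_def using norm_cauchy_schwarz by simp
    finally show ?thesis .
  qed
  have a0: "a m \<ge> 0" for m by (simp add: a_def)
  \<comment> \<open>In ratios, this says that the first one is at most every later one.\<close>
  have step: "a 1 * a m \<le> a 0 * a (Suc m)" for m
  proof (induction m)
    case (Suc m)
    show ?case
    proof (cases "a m = 0")
      case True
      then have "a (Suc m) = 0" using sq[of m] by simp
      then show ?thesis using a0 by simp
    next
      case False
      have "a m * (a 1 * a (Suc m)) \<le> a 0 * (a (Suc m))\<^sup>2"
        using mult_right_mono[OF Suc a0[of "Suc m"]] by (simp add: algebra_simps power2_eq_square)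
      also have "\<dots> \<le> a 0 * (a m * a (Suc (Suc m)))" by (intro mult_left_mono sq a0)
      finally have "a m * (a 1 * a (Suc m)) \<le> a m * (a 0 * a (Suc (Suc m)))" by (simp add: algebra_simps)
      then show ?thesis using False a0[of m] by simp
    qed
  qed simp
  have "a 1 ^ m * a 0 \<le> a 0 ^ m * a m"
  proof (induction m)
    case (Suc m)
    have "a 1 ^ Suc m * a 0 \<le> a 1 * (a 0 ^ m * a m)"
      using mult_left_mono[OF Suc a0[of 1]] by (simp add: algebra_simps)
    also have "\<dots> \<le> a 0 ^ m * (a 0 * a (Suc m))"
      using mult_left_mono[OF step[of m], of "a 0 ^ m"] a0[of 0] by (simp add: algebra_simps)
    finally show ?case by (simp add: algebra_simps)
  qed simp
  then show ?thesis by (simp add: a_def)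
qed

text \<open>
  A cycle of length \<open>l\<close> has \<open>2 * l\<close> ordered pairs in its support, so this excludes cycles of length
  at most \<open>2 * k\<close>.
\<close>

definition short_cycle_free :: "nat \<Rightarrow> 'n::finite graph \<Rightarrow> bool" where
  "short_cycle_free k R \<longleftrightarrow>
     (\<forall>B. circulation R B \<longrightarrow> card (support B) \<le> 4 * k \<longrightarrow> support B = {})"

section \<open>Distance layers around a vertex\<close>

context bipartite_graph
begin

text \<open>This is the graph distance from \<open>i\<close>, meaningful only for vertices reachable
  from \<open>i\<close>; hence the reachability assumptions below.\<close>

definition lev :: "'n \<Rightarrow> 'n \<Rightarrow> nat" where
  "lev i x = (LEAST j. (i, x) \<in> R ^^ j)"

lemma lev_le: "(i, x) \<in> R ^^ j \<Longrightarrow> lev i x \<le> j"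
  unfolding lev_def by (rule Least_le)

lemma relpow_lev: "(i, x) \<in> R\<^sup>* \<Longrightarrow> (i, x) \<in> R ^^ lev i x"
  unfolding lev_def rtrancl_power by (elim exE LeastI)

lemma relpow_parity: "(i, x) \<in> R ^^ j \<Longrightarrow> (x \<in> X) = ((i \<in> X) = even j)"
proof (induction j arbitrary: x)
  case (Suc j)
  then obtain y where "(i, y) \<in> R ^^ j" "(y, x) \<in> R" by auto
  then show ?case using Suc.IH[of y] bip[of y x] by auto
qed auto

text \<open>Levels of neighbours differ by at most one, and by bipartiteness their parities differ,
  so no edge stays inside a layer.\<close>

lemma lev_edge:
  assumes "(i, x) \<in> R\<^sup>*" "(x, y) \<in> R"
  shows "lev i y = Suc (lev i x) \<or> lev i x = Suc (lev i y)"
proof -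
  have y: "(i, y) \<in> R\<^sup>*" using assms by simp
  have "lev i y \<le> Suc (lev i x)" using relpow_lev[OF assms(1)] assms(2) by (intro lev_le) auto
  moreover have "lev i x \<le> Suc (lev i y)"
    using relpow_lev[OF y] assms(2) symE by (intro lev_le) auto
  moreover have "even (lev i x) \<noteq> even (lev i y)"
    using relpow_parity[OF relpow_lev[OF y]] relpow_parity[OF relpow_lev[OF assms(1)]]
      bip[OF assms(2)] by blast
  ultimately show ?thesis by presburger
qed

lemma geodesic:
  assumes "(i, x) \<in> R\<^sup>*"
  obtains p where "p 0 = i" "p (lev i x) = x" "\<And>s. s < lev i x \<Longrightarrow> (p s, p (Suc s)) \<in> R"
    "\<And>s. s \<le> lev i x \<Longrightarrow> lev i (p s) = s"
proof -
  obtain p where p: "p 0 = i" "p (lev i x) = x" "\<And>s. s < lev i x \<Longrightarrow> (p s, p (Suc s)) \<in> R"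
    using relpow_lev[OF assms] unfolding relpow_fun_conv by auto
  have r: "(i, p s) \<in> R ^^ s" if "s \<le> lev i x" for s
    using that by (induction s) (use p in auto)
  have up: "lev i (p s) \<le> s" if "s \<le> lev i x" for s using lev_le[OF r[OF that]] .
  \<comment> \<open>Going back from \<open>x\<close>, every step lowers the level by at most one.
    With the upper bound \<open>up\<close> this determines the level of every vertex on the
    path.\<close>
  have "lev i x \<le> lev i (p (lev i x - s)) + s" if "s \<le> lev i x" for s
    using that
  proof (induction s)
    case 0
    then show ?case using p by simp
  next
    case (Suc s)
    let ?s = "lev i x - Suc s"
    have eq: "lev i x - s = Suc ?s" using Suc.prems by simp
    have "(i, p ?s) \<in> R\<^sup>*" using r[of ?s] by (simp add: relpow_imp_rtrancl)
    moreover have "(p ?s, p (Suc ?s)) \<in> R" using p(3)[of ?s] Suc.prems by simp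
    ultimately have "lev i (p (Suc ?s)) \<le> Suc (lev i (p ?s))" using lev_edge by fastforce
    then show ?case using Suc eq by auto
  qed
  then have "s \<le> lev i (p s)" if "s \<le> lev i x" for s
    using that by (metis add_le_imp_le_diff diff_diff_cancel diff_le_self le_add_diff_inverse2 nat_add_left_cancel_le add.commute)
  with up have "lev i (p s) = s" if "s \<le> lev i x" for s using that by (simp add: le_antisym)
  then show ?thesis using that p by blast
qed

text \<open>Two distinct parents would give two geodesics from \<open>i\<close> that join at
  \<open>x\<close>. The resulting closed walk has length twice the level of \<open>x\<close>, at
  most \<open>2 * k\<close>, and contains a forbidden cycle. So the ball of radius \<open>k\<close>
  is a tree.\<close>

lemma unique_parent:
  assumes short: "short_cycle_free k R"
    and x: "(i, x) \<in> R\<^sup>*" "lev i x \<le> k"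
    and y: "(x, y) \<in> R" "lev i x = Suc (lev i y)"
    and z: "(x, z) \<in> R" "lev i x = Suc (lev i z)"
  shows "y = z"
proof (rule ccontr)
  assume "y \<noteq> z"
  define l where "l = lev i y"
  have "(i, y) \<in> R\<^sup>*" "(i, z) \<in> R\<^sup>*" using x y z by (auto intro: rtrancl_into_rtrancl)
  obtain p where p: "p 0 = i" "p l = y" "\<And>s. s < l \<Longrightarrow> (p s, p (Suc s)) \<in> R"
    "\<And>s. s \<le> l \<Longrightarrow> lev i (p s) = s"
    using geodesic[OF \<open>(i, y) \<in> R\<^sup>*\<close>] unfolding l_def by metis
  have lz: "lev i z = l" using y z by (simp add: l_def)
  obtain q where q: "q 0 = i" "q l = z" "\<And>s. s < l \<Longrightarrow> (q s, q (Suc s)) \<in> R"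
    "\<And>s. s \<le> l \<Longrightarrow> lev i (q s) = s"
    using geodesic[OF \<open>(i, z) \<in> R\<^sup>*\<close>] unfolding lz by metis
  define m where "m = 2 * l + 2"
  \<comment> \<open>The walk climbs from \<open>i\<close> along \<open>p\<close>, reaches
    \<open>x\<close> at index \<open>l + 1\<close> and descends along \<open>q\<close> back to
    \<open>i\<close>.\<close>
  define w where "w s = (if s \<le> l then p s else if s = Suc l then x else q (m - s))" for s
  have lx: "lev i x = Suc l" using y by (simp add: l_def)
  have lw: "lev i (w s) = min s (m - s)" if "s \<le> m" for s
    using that p(4)[of s] q(4)[of "m - s"] lx by (auto simp: w_def m_def)
  have "(w s, w (Suc s)) \<in> R" if "s < m" for s
  proof -
    consider "s < l" | "s = l" | "s = Suc l" | "s > Suc l" by linarith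
    then show ?thesis
    proof cases
      case 4
      then have "(q (m - Suc s), q (Suc (m - Suc s))) \<in> R" using that by (intro q(3)) (auto simp: m_def)
      moreover have "Suc (m - Suc s) = m - s" using that by simp
      ultimately show ?thesis using 4 symE by (simp add: w_def)
    qed (use p q y z symE in \<open>auto simp: w_def m_def\<close>)
  qed
  \<comment> \<open>Vertices two steps apart are on different levels, except around the top, where
    they are \<open>y\<close> and \<open>z\<close>.\<close>
  moreover have "w (s + 2) \<noteq> w s" if "s + 2 \<le> m" for s
  proof (cases "s = l")
    case True
    then show ?thesis using p q \<open>y \<noteq> z\<close> by (simp add: w_def m_def)
  next
    case False
    then have "lev i (w (s + 2)) \<noteq> lev i (w s)"
      using lw[of s] lw[of "s + 2"] that by (auto simp: m_def)
    then show ?thesis by metis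
  qed
  moreover have "\<not> inj_on w {..m}"
  proof
    assume "inj_on w {..m}"
    moreover have "w 0 = w m" using p q by (simp add: w_def m_def)
    ultimately show False unfolding inj_on_def by (auto simp: m_def)
  qed
  ultimately obtain B where B: "circulation R B" "support B \<noteq> {}" "card (support B) \<le> 2 * m"
    using walk_circulation by blast
  have "2 * m \<le> 4 * k" using x lx by (simp add: m_def)
  with B short show False unfolding short_cycle_free_def by (meson le_trans)
qed

text \<open>Split the edges by whether the column vertex is a child or a parent of the row vertex.
  As parents are unique, the first part has columns with at most one entry and the second has rows
  with at most one entry, so each contributes \<open>sqrt d\<close>.\<close>

lemma norm_adj_matrix_ball:
  assumes short: "short_cycle_free k R"
    and deg: "\<And>x. vertex_degree R x \<le> d"
    and g: "\<And>x. g $ x \<noteq> 0 \<Longrightarrow> (i, x) \<in> R\<^sup>* \<and> lev i x < k"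
  shows "norm (adj_matrix R *v g) \<le> 2 * sqrt (real d) * norm g"
proof -
  define Ch where "Ch = {(x, y) \<in> R. (i, y) \<in> R\<^sup>* \<and> lev i y < k \<and> lev i y = Suc (lev i x)}"
  define Pa where "Pa = {(x, y) \<in> R. (i, y) \<in> R\<^sup>* \<and> lev i y < k \<and> lev i x = Suc (lev i y)}"
  have deg': "card {x. (y, x) \<in> R} \<le> d" for y using deg[of y] by (simp add: vertex_degree_def)
  have one: "card {y. P y} \<le> 1" if "\<And>y z. P y \<Longrightarrow> P z \<Longrightarrow> y = z" for P :: "'n \<Rightarrow> bool"
    using that by (simp add: card_le_Suc0_iff_eq)
  have "norm (adj_matrix Ch *v g) \<le> sqrt (real d * real 1) * norm g"
  proof (rule norm_adj_matrix_mult)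
    show "card {y. (x, y) \<in> Ch} \<le> d" for x
    proof -
      have "{y. (x, y) \<in> Ch} \<subseteq> {y. (x, y) \<in> R}" by (auto simp: Ch_def)
      then show ?thesis using deg'[of x] card_mono[of "{y. (x, y) \<in> R}"] by (meson finite le_trans)
    qed
    show "card {x. (x, y) \<in> Ch} \<le> 1" for y
      using unique_parent[OF short, of i y] symE less_imp_le by (intro one) (auto simp: Ch_def)
  qed
  moreover have "norm (adj_matrix Pa *v g) \<le> sqrt (real 1 * real d) * norm g"
  proof (rule norm_adj_matrix_mult)
    show "card {x. (x, y) \<in> Pa} \<le> d" for y
    proof -
      have "{x. (x, y) \<in> Pa} \<subseteq> {x. (y, x) \<in> R}" using symE by (auto simp: Pa_def)
      then show ?thesis using deg'[of y] card_mono[of "{x. (y, x) \<in> R}"] by (meson finite le_trans)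
    qed
    show "card {y. (x, y) \<in> Pa} \<le> 1" for x
    proof (rule one)
      fix y z assume yz: "(x, y) \<in> Pa" "(x, z) \<in> Pa"
      \<comment> \<open>The row vertex \<open>x\<close> may lie on level \<open>k\<close> itself,
        just outside the support of \<open>g\<close>; parents are still unique there.\<close>
      then have "(i, x) \<in> R\<^sup>*" "lev i x \<le> k"
        using symE by (auto simp: Pa_def intro: rtrancl_into_rtrancl)
      with unique_parent[OF short] yz show "y = z" by (auto simp: Pa_def)
    qed
  qed
  moreover have disj: False if "(x, y) \<in> Ch" "(x, y) \<in> Pa" for x y
  proof -
    from that have "lev i y = Suc (lev i x)" "lev i x = Suc (lev i y)"
      unfolding Ch_def Pa_def by blast+
    then show False by linarith
  qed
  moreover have "adj_matrix R *v g = adj_matrix Ch *v g + adj_matrix Pa *v g"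
  proof -
    have "(\<Sum>y | (x, y) \<in> R. g $ y) = (\<Sum>y | (x, y) \<in> Ch. g $ y) + (\<Sum>y | (x, y) \<in> Pa. g $ y)" for x
    proof -
      have "(\<Sum>y | (x, y) \<in> R. g $ y) = (\<Sum>y\<in>{y. (x, y) \<in> Ch} \<union> {y. (x, y) \<in> Pa}. g $ y)"
      proof (rule sum.mono_neutral_right)
        show "\<forall>y\<in>{y. (x, y) \<in> R} - ({y. (x, y) \<in> Ch} \<union> {y. (x, y) \<in> Pa}). g $ y = 0"
        proof (safe, rule ccontr)
          fix y assume y: "(x, y) \<in> R" "(x, y) \<notin> Ch" "(x, y) \<notin> Pa" "g $ y \<noteq> 0"
          then show False using g[of y] lev_edge[of i y x] symE by (auto simp: Ch_def Pa_def)
        qed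
      qed (auto simp: Ch_def Pa_def)
      also have "\<dots> = (\<Sum>y | (x, y) \<in> Ch. g $ y) + (\<Sum>y | (x, y) \<in> Pa. g $ y)"
        by (rule sum.union_disjoint) (use disj in auto)
      finally show ?thesis .
    qed
    then show ?thesis by (simp add: vec_eq_iff adj_matrix_mult_nth)
  qed
  ultimately show ?thesis
    using norm_triangle_ineq[of "adj_matrix Ch *v g" "adj_matrix Pa *v g"] by (simp add: algebra_simps)
qed

text \<open>The ball estimate bounds the first \<open>k\<close> iterates on each basis vector.
  Expanding \<open>g\<close> in the basis costs a factor \<open>sqrt n\<close>, where
  \<open>n = CARD('n)\<close>, which the comparison of the norm with the \<open>k\<close>-th iterate
  reduces to its \<open>k\<close>-th root, at most \<open>sqrt 2\<close>.\<close>

lemma norm_adj_matrix_short_free: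
  assumes short: "short_cycle_free k R"
    and deg: "\<And>x. vertex_degree R x \<le> d"
    and k: "CARD('n) \<le> 2 ^ k" "k > 0"
  shows "norm (adj_matrix R *v g) \<le> sqrt (8 * real d) * norm g"
proof (cases "g = 0")
  case False
  let ?A = "(*v) (adj_matrix R)"
  have "(i, x) \<in> R ^^ m" if "(?A ^^ m) (axis i 1) $ x \<noteq> 0" for i x m
    using that
  proof (induction m arbitrary: x)
    case 0
    then show ?case by (simp add: axis_def split: if_splits)
  next
    case (Suc m)
    then obtain y where "(x, y) \<in> R" "(?A ^^ m) (axis i 1) $ y \<noteq> 0"
      by (auto simp: adj_matrix_mult_nth elim!: sum.not_neutral_contains_not_neutral)
    then show ?case using Suc.IH[of y] symE by auto
  qed
  note supp = this
  have pow: "norm ((?A ^^ m) (axis i 1)) \<le> (2 * sqrt (real d)) ^ m" if "m \<le> k" for m i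
    using that
  proof (induction m)
    case (Suc m)
    have "norm ((?A ^^ Suc m) (axis i 1)) \<le> 2 * sqrt (real d) * norm ((?A ^^ m) (axis i 1))"
      using norm_adj_matrix_ball[OF short deg, of "(?A ^^ m) (axis i 1)" i]
        le_less_trans[OF lev_le[OF supp]] relpow_imp_rtrancl[OF supp] Suc.prems by simp
    also have "\<dots> \<le> 2 * sqrt (real d) * (2 * sqrt (real d)) ^ m"
      using Suc by (intro mult_left_mono) auto
    finally show ?case by simp
  qed simp
  have lin: "linear (?A ^^ m)" for m
  proof (induction m)
    case (Suc m)
    have "linear (?A \<circ> (?A ^^ m))" by (rule linear_compose[OF Suc matrix_vector_mul_linear])
    then show ?case by (simp add: o_def)
  qed (simp add: linear_iff)
  have "(?A ^^ k) g = (?A ^^ k) (\<Sum>i\<in>UNIV. g $ i *\<^sub>R axis i 1)"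
    using basis_expansion[of g] by (simp add: scalar_mult_eq_scaleR)
  also have "\<dots> = (\<Sum>i\<in>UNIV. g $ i *\<^sub>R (?A ^^ k) (axis i 1))"
    by (simp add: linear_sum[OF lin] linear_cmul[OF lin] o_def)
  finally have "norm ((?A ^^ k) g) \<le> (\<Sum>i\<in>UNIV. \<bar>g $ i\<bar> * (2 * sqrt (real d)) ^ k)"
    using pow[of k] by (auto intro!: sum_norm_le mult_left_mono)
  also have "\<dots> = (\<Sum>i\<in>UNIV. \<bar>g $ i\<bar>) * (2 * sqrt (real d)) ^ k" by (simp add: sum_distrib_right)
  also have "\<dots> \<le> (sqrt CARD('n) * norm g) * (2 * sqrt (real d)) ^ k"
  proof (intro mult_right_mono)
    have "(\<Sum>i\<in>UNIV. \<bar>g $ i\<bar>)\<^sup>2 \<le> (\<Sum>i\<in>UNIV. \<bar>g $ i\<bar>\<^sup>2) * CARD('n)"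
      by (rule sum_squared_le_sum_of_squares)
    also have "\<dots> = (sqrt CARD('n) * norm g)\<^sup>2" by (simp add: norm_vec_squared power_mult_distrib)
    finally show "(\<Sum>i\<in>UNIV. \<bar>g $ i\<bar>) \<le> sqrt CARD('n) * norm g" by (rule power2_le_imp_le) simp
  qed simp
  finally have pk: "norm ((?A ^^ k) g) \<le> sqrt CARD('n) * norm g * (2 * sqrt (real d)) ^ k" .
  have "norm (?A g) ^ k * norm g \<le> norm g ^ k * norm ((?A ^^ k) g)"
    using symE by (intro norm_symmetric_power) (simp add: adj_matrix_def)
  also have "\<dots> \<le> norm g ^ k * (sqrt CARD('n) * norm g * (2 * sqrt (real d)) ^ k)"
    using pk by (intro mult_left_mono) auto
  finally have Ag: "norm (?A g) ^ k \<le> sqrt CARD('n) * (2 * sqrt (real d) * norm g) ^ k"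
    using False by (simp add: power_mult_distrib mult_ac)
  define c where "c = 2 * sqrt (real d) * norm g"
  have "(norm (?A g) ^ k)\<^sup>2 \<le> (sqrt CARD('n) * c ^ k)\<^sup>2"
    using Ag by (intro power_mono) (auto simp: c_def)
  also have "\<dots> = CARD('n) * (c\<^sup>2) ^ k"
    by (simp add: power_mult_distrib mult.commute[of k 2] flip: power_mult)
  \<comment> \<open>Here \<open>n \<le> 2 ^ k\<close> is absorbed: under the \<open>k\<close>-th
    power the squared bound doubles from \<open>4 * d\<close> to \<open>8 * d\<close>.\<close>
  also have "\<dots> \<le> 2 ^ k * (c\<^sup>2) ^ k"
    using k(1) of_nat_mono[of "CARD('n)" "2 ^ k", where 'a = real] by (intro mult_right_mono) auto
  also have "\<dots> = ((sqrt (8 * real d) * norm g)\<^sup>2) ^ k"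
    by (simp add: c_def power_mult_distrib flip: power_mult_distrib[of 2])
  finally have "((norm (?A g))\<^sup>2) ^ k \<le> ((sqrt (8 * real d) * norm g)\<^sup>2) ^ k"
    by (simp add: mult.commute flip: power_mult)
  then have "(norm (?A g))\<^sup>2 \<le> (sqrt (8 * real d) * norm g)\<^sup>2"
    using k(2) by (subst (asm) power_mono_iff) auto
  then show ?thesis by (rule power2_le_imp_le) simp
qed simp

end

section \<open>Random signs on short cycles\<close>

lemma cosh_le_exp: "(exp x + exp (- x)) / 2 \<le> exp (x\<^sup>2 / 2)" for x :: real
proof -
  have *: "(exp y + exp (- y)) / 2 \<le> exp (y\<^sup>2 / 2)" if "y \<ge> 0" for y :: real
  proof -
    have pos: "1 + 1 / 2 * (exp (2 * y) - 1) > (0 :: real)"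
    proof -
      have "1 + 1 / 2 * (exp (2 * y) - 1) = (1 + exp (2 * y)) / 2" by (simp add: field_simps)
      also have "\<dots> > 0" by (simp add: add_pos_pos)
      finally show ?thesis .
    qed
    \<comment> \<open>This is the exponent bound behind Hoeffding's lemma for a fair two-point
      variable of range \<open>2 * y\<close>, in which
      \<open>(2 * y)^2 / 8 = y^2 / 2\<close>.\<close>
    have "- (2 * y) * (1 / 2) + ln (1 + 1 / 2 * (exp (2 * y) - 1)) \<le> (2 * y)\<^sup>2 / 8"
      by (rule Hoeffdings_lemma_aux) (use that in auto)
    then have "ln (1 + 1 / 2 * (exp (2 * y) - 1)) \<le> y\<^sup>2 / 2 + y"
      by (simp add: power_mult_distrib)
    then have "1 + 1 / 2 * (exp (2 * y) - 1) \<le> exp (y\<^sup>2 / 2 + y)"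
      using pos by (metis exp_le_cancel_iff exp_ln)
    then have "exp (- y) * (1 + 1 / 2 * (exp (2 * y) - 1)) \<le> exp (- y) * exp (y\<^sup>2 / 2 + y)"
      by (intro mult_left_mono) auto
    also have "\<dots> = exp (y\<^sup>2 / 2)" by (simp flip: exp_add)
    also have "exp (- y) * (1 + 1 / 2 * (exp (2 * y) - 1)) = (exp (- y) + exp (- y) * exp (2 * y)) / 2"
      by (simp add: algebra_simps)
    also have "\<dots> = (exp y + exp (- y)) / 2" by (simp flip: exp_add)
    finally show ?thesis .
  qed
  from *[of x] *[of "- x"] show ?thesis by (cases "x \<ge> 0") (auto simp: add.commute)
qed

text \<open>Chernoff's method for \<open>f\<close> and \<open>- f\<close>; the moment bound is
  assumed for \<open>l\<close> of either sign, so it covers both.\<close>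

lemma subgaussian_tail:
  fixes f :: "'a \<Rightarrow> real"
  assumes mgf: "\<And>l. (\<integral>\<^sup>+x. ennreal (exp (l * f x)) \<partial>measure_pmf p) \<le> ennreal (exp (l\<^sup>2 * V / 2))"
    and V: "V > 0" and s: "s \<ge> 0"
  shows "measure_pmf.prob p {x. \<bar>f x\<bar> > s} \<le> 2 * exp (- s\<^sup>2 / (2 * V))"
proof -
  have one_sided: "measure_pmf.prob p {x. g x > s} \<le> exp (- s\<^sup>2 / (2 * V))"
    if g: "\<And>l. (\<integral>\<^sup>+x. ennreal (exp (l * g x)) \<partial>measure_pmf p) \<le> ennreal (exp (l\<^sup>2 * V / 2))"
    for g :: "'a \<Rightarrow> real"
  proof -
    \<comment> \<open>This value minimizes the exponent \<open>l^2 * V / 2 - l * s\<close>.\<close>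
    define l where "l = s / V"
    have l: "l \<ge> 0" using s V by (simp add: l_def)
    have "emeasure p {x. g x > s} = (\<integral>\<^sup>+x. indicator {x. g x > s} x \<partial>measure_pmf p)" by simp
    also have "\<dots> \<le> (\<integral>\<^sup>+x. ennreal (exp (- l * s)) * ennreal (exp (l * g x)) \<partial>measure_pmf p)"
    proof (rule nn_integral_mono)
      fix x
      have "1 \<le> exp (- l * s) * exp (l * g x)" if "g x > s"
        using mult_left_mono[OF less_imp_le[OF that] l] by (simp flip: exp_add)
      then show "indicator {x. g x > s} x \<le> ennreal (exp (- l * s)) * ennreal (exp (l * g x))"
        by (auto simp: indicator_def ennreal_mult[symmetric] simp del: mult_minus_left)
    qed
    also have "\<dots> = ennreal (exp (- l * s)) * (\<integral>\<^sup>+x. ennreal (exp (l * g x)) \<partial>measure_pmf p)"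
      by (rule nn_integral_cmult) simp
    also have "\<dots> \<le> ennreal (exp (- l * s)) * ennreal (exp (l\<^sup>2 * V / 2))"
      by (intro mult_left_mono g) simp
    also have "\<dots> = ennreal (exp (- s\<^sup>2 / (2 * V)))"
      using V by (simp add: ennreal_mult[symmetric] exp_add[symmetric] l_def power2_eq_square field_simps)
    finally show ?thesis by (simp add: measure_pmf.emeasure_eq_measure)
  qed
  have "measure_pmf.prob p {x. \<bar>f x\<bar> > s} \<le> measure_pmf.prob p ({x. f x > s} \<union> {x. - f x > s})"
    by (rule measure_pmf.finite_measure_mono) auto
  also have "\<dots> \<le> measure_pmf.prob p {x. f x > s} + measure_pmf.prob p {x. - f x > s}"
    by (rule measure_Un_le) auto
  also have "\<dots> \<le> exp (- s\<^sup>2 / (2 * V)) + exp (- s\<^sup>2 / (2 * V))"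
  proof (intro add_mono one_sided)
    show "(\<integral>\<^sup>+x. ennreal (exp (l * - f x)) \<partial>measure_pmf p) \<le> ennreal (exp (l\<^sup>2 * V / 2))" for l
      using mgf[of "- l"] by simp
  qed (rule mgf)
  finally show ?thesis by simp
qed

lemma bilinear_expand: "u \<bullet> ((S :: real ^ 'n ^ 'm) *v v) = (\<Sum>x\<in>UNIV. \<Sum>y\<in>UNIV. u $ x * S $ x $ y * v $ y)"
  by (simp add: inner_vec_def matrix_vector_mult_def sum_distrib_left mult.assoc)

lemma bilinear_le_support:
  fixes u v :: "real ^ 'n::finite" and B :: "'n \<Rightarrow> 'n \<Rightarrow> real"
  assumes "\<And>x y. \<bar>B x y\<bar> \<le> 1"
  shows "\<bar>u \<bullet> ((\<chi> x y. B x y) *v v)\<bar> \<le> card (support B) * (infnorm u * infnorm v)"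
proof -
  have "u \<bullet> ((\<chi> x y. B x y) *v v) = (\<Sum>(x, y)\<in>UNIV. u $ x * B x y * v $ y)"
    by (simp add: bilinear_expand sum.cartesian_product)
  also have "\<dots> = (\<Sum>(x, y)\<in>support B. u $ x * B x y * v $ y)"
    by (rule sum.mono_neutral_right) (auto simp: support_def)
  finally have "\<bar>u \<bullet> ((\<chi> x y. B x y) *v v)\<bar> = \<bar>\<Sum>(x, y)\<in>support B. u $ x * B x y * v $ y\<bar>" by simp
  also have "\<dots> \<le> (\<Sum>e\<in>support B. infnorm u * infnorm v)"
  proof (rule order_trans[OF sum_abs], rule sum_mono)
    fix e assume "e \<in> support B"
    obtain x y where e: "e = (x, y)" by fastforce
    have "\<bar>u $ x * B x y * v $ y\<bar> = \<bar>u $ x\<bar> * \<bar>v $ y\<bar> * \<bar>B x y\<bar>" by (simp add: abs_mult)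
    also have "\<dots> \<le> \<bar>u $ x\<bar> * \<bar>v $ y\<bar>" using assms by (intro mult_right_le_one_le) auto
    also have "\<dots> \<le> infnorm u * infnorm v"
      by (intro mult_mono component_le_infnorm_cart) (auto simp: infnorm_pos_le)
    finally show "\<bar>case e of (x, y) \<Rightarrow> u $ x * B x y * v $ y\<bar> \<le> infnorm u * infnorm v"
      by (simp add: e)
  qed
  finally show ?thesis by simp
qed

text \<open>The entries equal to 1 then form a graph that has half the degree of \<open>D\<close> at
  every vertex.\<close>

definition balanced_signing :: "'n::finite graph \<Rightarrow> real ^ 'n ^ 'n \<Rightarrow> bool" where
  "balanced_signing D S \<longleftrightarrow> (\<forall>x y. S $ x $ y = S $ y $ x) \<and>
     (\<forall>x y. \<bar>S $ x $ y\<bar> = of_bool ((x, y) \<in> D)) \<and> (\<forall>x. (\<Sum>y\<in>UNIV. S $ x $ y) = 0)"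

lemma nn_integral_random_sign:
  fixes a b :: real
  shows "(\<integral>\<^sup>+e. ennreal (exp (a + e * b)) \<partial>measure_pmf (pmf_of_set {- 1, 1}))
    \<le> ennreal (exp a * exp (b\<^sup>2 / 2))"
proof -
  have "(\<integral>\<^sup>+e. ennreal (exp (a + e * b)) \<partial>measure_pmf (pmf_of_set {- 1, 1 :: real}))
      = (ennreal (exp (a - b)) + ennreal (exp (a + b))) / 2"
    by (subst nn_integral_pmf_of_set) auto
  also have "\<dots> = ennreal ((exp (a - b) + exp (a + b)) / 2)"
    by (simp add: ennreal_plus[symmetric] divide_ennreal[symmetric] ennreal_numeral[symmetric]
        del: ennreal_plus ennreal_numeral)
  also have "(exp (a - b) + exp (a + b)) / 2 = exp a * ((exp b + exp (- b)) / 2)"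
    by (simp add: exp_add exp_diff exp_minus field_simps)
  also have "ennreal \<dots> \<le> ennreal (exp a * exp (b\<^sup>2 / 2))"
    by (intro ennreal_leI mult_left_mono cosh_le_exp) auto
  finally show ?thesis .
qed

text \<open>Induction on the number of edges: remove one short circulation, sign the rest, and add
  the circulation with an independent fair sign. The remainder \<open>R0\<close> is fixed before the
  signs are drawn, so it can later be split deterministically.\<close>

lemma random_short_cycle_signing:
  fixes R :: "'n::finite graph"
  assumes "bipartite_graph X R"
  shows "\<exists>R0 (q :: (real ^ 'n ^ 'n) pmf). R0 \<subseteq> R \<and> sym R0 \<and> short_cycle_free k R0 \<and>
    (\<forall>S\<in>set_pmf q. balanced_signing (R - R0) S) \<and>
    (\<forall>u v. (\<integral>\<^sup>+S. ennreal (exp (u \<bullet> (S *v v))) \<partial>measure_pmf q)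
       \<le> ennreal (exp (2 * k * card (R - R0) * (infnorm u * infnorm v)\<^sup>2)))"
  using assms
proof (induction "card R" arbitrary: R rule: less_induct)
  case less
  interpret bipartite_graph X R by fact
  show ?case
  proof (cases "short_cycle_free k R")
    case True
    then show ?thesis
      by (intro exI[of _ R] exI[of _ "return_pmf 0"]) (auto simp: sym balanced_signing_def)
  next
    case False
    then obtain B where B: "circulation R B" "card (support B) \<le> 4 * k" "support B \<noteq> {}"
      unfolding short_cycle_free_def by blast
    define M where "M = (\<chi> x y. B x y)"
    have Bval: "B x y = - 1 \<or> B x y = 0 \<or> B x y = 1" and Bsym: "B x y = B y x"
      and Bsum: "(\<Sum>y\<in>UNIV. B x y) = 0" for x y
      using B(1) by (auto simp: circulation_def)
    have suppR: "support B \<subseteq> R" using B(1) by (auto simp: circulation_def support_def)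
    have "card (R - support B) < card R"
      using suppR B(3) by (intro psubset_card_mono) auto
    moreover have "bipartite_graph X (R - support B)"
      using symE Bsym by (intro subgraph) (auto simp: sym_def support_def)
    ultimately obtain R0 and q :: "(real ^ 'n ^ 'n) pmf" where
      IH: "R0 \<subseteq> R - support B \<and> sym R0 \<and> short_cycle_free k R0 \<and>
        (\<forall>S\<in>set_pmf q. balanced_signing (R - support B - R0) S) \<and>
        (\<forall>u v. (\<integral>\<^sup>+S. ennreal (exp (u \<bullet> (S *v v))) \<partial>measure_pmf q)
          \<le> ennreal (exp (2 * k * card (R - support B - R0) * (infnorm u * infnorm v)\<^sup>2)))"
      using less.hyps[of "R - support B"] by (elim exE meta_impE)
    then have R0: "R0 \<subseteq> R - support B" "sym R0" "short_cycle_free k R0"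
      and q: "\<And>S. S \<in> set_pmf q \<Longrightarrow> balanced_signing (R - support B - R0) S"
      and mgf: "\<And>u v. (\<integral>\<^sup>+S. ennreal (exp (u \<bullet> (S *v v))) \<partial>measure_pmf q)
        \<le> ennreal (exp (2 * k * card (R - support B - R0) * (infnorm u * infnorm v)\<^sup>2))"
      by blast+
    define q' where "q' = bind_pmf q (\<lambda>S. map_pmf (\<lambda>e. S + e *\<^sub>R M) (pmf_of_set {- 1, 1}))"
    have "balanced_signing (R - R0) S" if "S \<in> set_pmf q'" for S
    proof -
      have "S \<in> (\<Union>S'\<in>set_pmf q. (\<lambda>e. S' + e *\<^sub>R M) ` {- 1, 1})"
        using that by (simp add: q'_def)
      then obtain S' e where S: "S = S' + e *\<^sub>R M" "S' \<in> set_pmf q" "e = 1 \<or> e = - 1"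
        by blast
      have S': "S' $ x $ y = S' $ y $ x" "\<bar>S' $ x $ y\<bar> = of_bool ((x, y) \<in> R - support B - R0)"
        "(\<Sum>y\<in>UNIV. S' $ x $ y) = 0" for x y
        using q[OF S(2)] by (auto simp: balanced_signing_def)
      have nth: "S $ x $ y = S' $ x $ y + e * B x y" for x y by (simp add: S M_def)
      have "\<bar>S $ x $ y\<bar> = of_bool ((x, y) \<in> R - R0)" for x y
      proof (cases "(x, y) \<in> support B")
        case True
        then have "(x, y) \<in> R - R0" using suppR R0 by auto
        moreover have "S' $ x $ y = 0" using S'(2)[of x y] True by auto
        ultimately show ?thesis using True Bval[of x y] S(3) by (auto simp: nth support_def)
      next
        case False
        then show ?thesis using S'(2)[of x y] by (auto simp: nth support_def)
      qed
      moreover have "(\<Sum>y\<in>UNIV. S $ x $ y) = 0" for x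
        by (simp add: nth sum.distrib sum_distrib_left[symmetric] S'(3) Bsum)
      moreover have "S $ x $ y = S $ y $ x" for x y using S'(1)[of x y] Bsym[of x y] by (simp add: nth)
      ultimately show ?thesis by (simp add: balanced_signing_def)
    qed
    moreover have "(\<integral>\<^sup>+S. ennreal (exp (u \<bullet> (S *v v))) \<partial>measure_pmf q')
       \<le> ennreal (exp (2 * k * card (R - R0) * (infnorm u * infnorm v)\<^sup>2))" for u v
    proof -
      let ?c = "infnorm u * infnorm v" and ?b = "u \<bullet> (M *v v)" and ?N = "real (card (support B))"
      have c: "?c \<ge> 0" by (simp add: infnorm_pos_le)
      have "\<bar>?b\<bar> \<le> ?N * ?c"
        unfolding M_def
      proof (rule bilinear_le_support)
        show "\<bar>B x y\<bar> \<le> 1" for x y using Bval[of x y] by auto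
      qed
      then have "?b\<^sup>2 \<le> (?N * ?c)\<^sup>2" using c by (metis abs_ge_zero power2_abs power_mono)
      also have "\<dots> = ?N * (?N * ?c\<^sup>2)" by (simp add: power2_eq_square)
      \<comment> \<open>Only one of the two factors \<open>?N\<close> is bounded by the cycle
        length. The other is kept, so that the exponents of disjoint circulations add up to a
        multiple of the number of removed edges.\<close>
      also have "\<dots> \<le> real (4 * k) * (?N * ?c\<^sup>2)"
        using B(2) by (intro mult_right_mono) auto
      finally have b: "?b\<^sup>2 / 2 \<le> 2 * k * ?N * ?c\<^sup>2" by simp
      have card: "card (R - R0) = card (R - support B - R0) + card (support B)"
      proof -
        have eq: "R - R0 = (R - support B - R0) \<union> support B" using suppR R0 by auto
        show ?thesis unfolding eq by (rule card_Un_disjoint) auto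
      qed
      have "(\<integral>\<^sup>+S. ennreal (exp (u \<bullet> (S *v v))) \<partial>measure_pmf q')
        = (\<integral>\<^sup>+S. \<integral>\<^sup>+e. ennreal (exp (u \<bullet> (S *v v) + e * ?b)) \<partial>measure_pmf (pmf_of_set {- 1, 1}) \<partial>measure_pmf q)"
        by (simp add: q'_def matrix_vector_mult_add_rdistrib scaleR_matrix_vector_assoc[symmetric] inner_add_right)
      also have "\<dots> \<le> (\<integral>\<^sup>+S. ennreal (exp (u \<bullet> (S *v v)) * exp (?b\<^sup>2 / 2)) \<partial>measure_pmf q)"
        by (intro nn_integral_mono nn_integral_random_sign)
      also have "\<dots> = (\<integral>\<^sup>+S. ennreal (exp (u \<bullet> (S *v v))) \<partial>measure_pmf q) * ennreal (exp (?b\<^sup>2 / 2))"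
        by (simp add: ennreal_mult nn_integral_multc)
      also have "\<dots> \<le> ennreal (exp (2 * k * card (R - support B - R0) * ?c\<^sup>2)) * ennreal (exp (2 * k * ?N * ?c\<^sup>2))"
        using b by (intro mult_mono mgf) auto
      also have "\<dots> = ennreal (exp (2 * k * card (R - R0) * ?c\<^sup>2))"
        by (simp add: ennreal_mult[symmetric] exp_add[symmetric] card algebra_simps)
      finally show ?thesis .
    qed
    ultimately show ?thesis using R0 by (intro exI[of _ R0] exI[of _ q']) auto
  qed
qed

section \<open>Random factors\<close>

lemma spectral_norm_le:
  assumes "\<And>x. norm (M *v x) \<le> r * norm x"
  shows "spectral_norm M \<le> r"
  unfolding spectral_norm_def using assms by (rule onorm_le)

lemma norm_matrix_mult_le: "norm (M *v x) \<le> spectral_norm M * norm x"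
  unfolding spectral_norm_def by (rule onorm) simp

lemma matrix_vector_mult_uminus: "(- M) *v x = - (M *v x)" for M :: "real ^ 'n ^ 'm"
  by (simp add: vec_eq_iff matrix_vector_mult_def sum_negf)

lemma spectral_norm_add: "spectral_norm (M + N) \<le> spectral_norm M + spectral_norm N"
proof (rule spectral_norm_le)
  fix x
  have "norm ((M + N) *v x) \<le> norm (M *v x) + norm (N *v x)"
    by (simp add: matrix_vector_mult_add_rdistrib norm_triangle_ineq)
  also have "\<dots> \<le> (spectral_norm M + spectral_norm N) * norm x"
    using norm_matrix_mult_le[of M x] norm_matrix_mult_le[of N x] by (simp add: algebra_simps)
  finally show "norm ((M + N) *v x) \<le> (spectral_norm M + spectral_norm N) * norm x" .
qed

lemma spectral_norm_scaleR: "spectral_norm (c *\<^sub>R M) \<le> \<bar>c\<bar> * spectral_norm M"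
proof (rule spectral_norm_le)
  fix x
  have "norm ((c *\<^sub>R M) *v x) = \<bar>c\<bar> * norm (M *v x)"
    by (simp add: scaleR_matrix_vector_assoc[symmetric])
  also have "\<dots> \<le> \<bar>c\<bar> * (spectral_norm M * norm x)"
    by (intro mult_left_mono norm_matrix_mult_le) auto
  finally show "norm ((c *\<^sub>R M) *v x) \<le> \<bar>c\<bar> * spectral_norm M * norm x" by (simp add: mult.assoc)
qed

text \<open>Replacing \<open>g\<close> by its entrywise absolute value keeps its norm and can only
  enlarge the image. This bounds a signed version of a graph by the graph itself.\<close>

lemma spectral_norm_dominated:
  assumes dom: "\<And>x y. \<bar>M $ x $ y\<bar> \<le> A $ x $ y"
  shows "spectral_norm M \<le> spectral_norm A"
proof (rule spectral_norm_le)
  fix g :: "real ^ 'a"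
  define h where "h = (\<chi> y. \<bar>g $ y\<bar>)"
  have "\<bar>(M *v g) $ x\<bar> \<le> \<bar>(A *v h) $ x\<bar>" for x
  proof -
    have "\<bar>(M *v g) $ x\<bar> \<le> (\<Sum>y\<in>UNIV. \<bar>M $ x $ y * g $ y\<bar>)"
      unfolding matrix_vector_mult_def by (simp add: sum_abs)
    also have "\<dots> \<le> (\<Sum>y\<in>UNIV. A $ x $ y * h $ y)"
      unfolding h_def by (intro sum_mono) (simp add: abs_mult mult_right_mono dom)
    also have "\<dots> \<le> \<bar>(A *v h) $ x\<bar>" unfolding matrix_vector_mult_def by simp
    finally show ?thesis .
  qed
  then have "norm (M *v g) \<le> norm (A *v h)" by (auto intro!: norm_le_componentwise_cart)
  also have "\<dots> \<le> spectral_norm A * norm h" by (rule norm_matrix_mult_le)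
  also have "norm h = norm g" unfolding norm_vec_def h_def by (simp add: L2_set_def)
  finally show "norm (M *v g) \<le> spectral_norm A * norm g" .
qed

lemma spectral_norm_adj_regular:
  assumes "sym G" "regular d G"
  shows "spectral_norm (adj_matrix G) \<le> d"
proof (rule spectral_norm_le)
  fix g
  have "{x. (x, y) \<in> G} = {x. (y, x) \<in> G}" for y using \<open>sym G\<close> by (auto dest: symD)
  then have "norm (adj_matrix G *v g) \<le> sqrt (real d * real d) * norm g"
    using assms(2) by (intro norm_adj_matrix_mult) (simp_all add: regular_def vertex_degree_def)
  then show "norm (adj_matrix G *v g) \<le> d * norm g" by simp
qed

section \<open>Degree counts and distributions on factors\<close>

lemma vertex_degree_sum: "real (vertex_degree H x) = (\<Sum>y\<in>UNIV. adj_matrix H $ x $ y)"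
  by (simp add: vertex_degree_def adj_matrix_def sum.If_cases)

lemma card_regular:
  assumes "regular d G"
  shows "card (G :: 'n::finite graph) = d * CARD('n)"
proof -
  have "card (SIGMA x:UNIV. {y. (x, y) \<in> G}) = (\<Sum>x\<in>(UNIV :: 'n set). card {y. (x, y) \<in> G})"
    by simp
  moreover have "(SIGMA x:UNIV. {y. (x, y) \<in> G}) = G" by auto
  ultimately show ?thesis using assms by (simp add: regular_def vertex_degree_def mult.commute)
qed

text \<open>The parameters are the bound \<open>r\<close> on the norm of \<open>M\<close>, the scale
  \<open>s\<close> of the deviation and the prefactor \<open>h\<close> of the tail. A discrete
  distribution keeps every event measurable until the final passage to a Borel structure.\<close>

definition random_factor :: "nat \<Rightarrow> nat \<Rightarrow> 'n::finite graph \<Rightarrow> real \<Rightarrow> real \<Rightarrow> real \<Rightarrow> bool" where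
  "random_factor a d G r s h \<longleftrightarrow> (\<exists>p :: ('n graph \<times> (real ^ 'n ^ 'n)) pmf.
     set_pmf p \<subseteq> factors a G \<times> {M. spectral_norm M \<le> r} \<and>
     (\<forall>u v t. t \<ge> 0 \<longrightarrow> measure_pmf.prob p {(H, M).
         \<bar>u \<bullet> ((adj_matrix H - (real a / real d) *\<^sub>R adj_matrix G + M) *v v)\<bar>
           > t * s * infnorm u * infnorm v} \<le> h * exp (- t\<^sup>2 / 2)))"

lemma random_factor_mono:
  assumes "random_factor a d G r s h" "r \<le> r'" "s \<le> s'" "h \<le> h'"
  shows "random_factor a d G r' s' h'"
proof -
  obtain p where p: "set_pmf p \<subseteq> factors a G \<times> {M. spectral_norm M \<le> r}"
    and tail: "\<And>u v t. t \<ge> 0 \<Longrightarrow> measure_pmf.prob p {(H, M).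
         \<bar>u \<bullet> ((adj_matrix H - (real a / real d) *\<^sub>R adj_matrix G + M) *v v)\<bar>
           > t * s * infnorm u * infnorm v} \<le> h * exp (- t\<^sup>2 / 2)"
    using assms(1) unfolding random_factor_def by blast
  have "measure_pmf.prob p {(H, M).
         \<bar>u \<bullet> ((adj_matrix H - (real a / real d) *\<^sub>R adj_matrix G + M) *v v)\<bar>
           > t * s' * infnorm u * infnorm v} \<le> h' * exp (- t\<^sup>2 / 2)" if "t \<ge> 0" for u v t
  proof -
    have le: "t * s * infnorm u * infnorm v \<le> t * s' * infnorm u * infnorm v"
      using that assms(3) by (intro mult_right_mono mult_left_mono infnorm_pos_le)
    have "measure_pmf.prob p {(H, M).
         \<bar>u \<bullet> ((adj_matrix H - (real a / real d) *\<^sub>R adj_matrix G + M) *v v)\<bar>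
           > t * s' * infnorm u * infnorm v} \<le> measure_pmf.prob p {(H, M).
         \<bar>u \<bullet> ((adj_matrix H - (real a / real d) *\<^sub>R adj_matrix G + M) *v v)\<bar>
           > t * s * infnorm u * infnorm v}"
      by (rule measure_pmf.finite_measure_mono) (use le in auto)
    also have "\<dots> \<le> h * exp (- t\<^sup>2 / 2)" by (rule tail[OF that])
    also have "\<dots> \<le> h' * exp (- t\<^sup>2 / 2)" using assms(4) by (intro mult_right_mono) auto
    finally show ?thesis .
  qed
  moreover have "set_pmf p \<subseteq> factors a G \<times> {M. spectral_norm M \<le> r'}" using p assms(2) by force
  ultimately show ?thesis unfolding random_factor_def by blast
qed

text \<open>For a fixed factor the whole error is placed in \<open>M\<close>, so nothing is left to
  deviate.\<close>

lemma random_factor_const: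
  assumes "H \<in> factors a G" "spectral_norm ((real a / real d) *\<^sub>R adj_matrix G - adj_matrix H) \<le> r"
  shows "random_factor a d G r 0 0"
  unfolding random_factor_def
proof (intro exI[of _ "return_pmf (H, (real a / real d) *\<^sub>R adj_matrix G - adj_matrix H)"] conjI allI impI)
qed (use assms in \<open>auto simp: measure_return_pmf\<close>)

text \<open>Passing from \<open>(H, M)\<close> to \<open>(G - H, - M)\<close> only changes the sign
  of the error matrix.\<close>

lemma random_factor_complement:
  assumes G: "simple_graph G" "regular d G" "d > 0" and a: "a \<le> d"
    and rf: "random_factor a d G r s h"
  shows "random_factor (d - a) d G r s h"
proof -
  obtain p where p: "set_pmf p \<subseteq> factors a G \<times> {M. spectral_norm M \<le> r}"
    and tail: "\<And>u v t. t \<ge> 0 \<Longrightarrow> measure_pmf.prob p {(H, M).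
         \<bar>u \<bullet> ((adj_matrix H - (real a / real d) *\<^sub>R adj_matrix G + M) *v v)\<bar>
           > t * s * infnorm u * infnorm v} \<le> h * exp (- t\<^sup>2 / 2)"
    using rf unfolding random_factor_def by blast
  define f where "f = (\<lambda>(H, M). (G - H, - M :: real ^ 'a ^ 'a))"
  have "G - H \<in> factors (d - a) G" if "H \<in> factors a G" for H
  proof -
    have "vertex_degree (G - H) x = d - a" for x
    proof -
      have "{y. (x, y) \<in> G - H} = {y. (x, y) \<in> G} - {y. (x, y) \<in> H}" by auto
      moreover have "card \<dots> = card {y. (x, y) \<in> G} - card {y. (x, y) \<in> H}"
        using that by (intro card_Diff_subset) (auto simp: factors_def)
      ultimately show ?thesis
        using that G(2) by (simp add: vertex_degree_def regular_def factors_def)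
    qed
    then show ?thesis
      using that G(1) by (auto simp: factors_def simple_graph_def regular_def sym_def irrefl_def)
  qed
  moreover have "spectral_norm (- M) = spectral_norm M" for M :: "real ^ 'a ^ 'a"
    by (simp add: spectral_norm_def matrix_vector_mult_uminus onorm_neg)
  ultimately have sub: "set_pmf (map_pmf f p) \<subseteq> factors (d - a) G \<times> {M. spectral_norm M \<le> r}"
    using p by (auto simp: f_def)
  have "measure_pmf.prob (map_pmf f p) {(H, M).
         \<bar>u \<bullet> ((adj_matrix H - (real (d - a) / real d) *\<^sub>R adj_matrix G + M) *v v)\<bar>
           > t * s * infnorm u * infnorm v} \<le> h * exp (- t\<^sup>2 / 2)" if "t \<ge> 0" for u v t
  proof -
    have eq: "adj_matrix (G - H) - (real (d - a) / real d) *\<^sub>R adj_matrix G - M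
        = - (adj_matrix H - (real a / real d) *\<^sub>R adj_matrix G + M)"
      if "(H, M) \<in> set_pmf p" for H M
    proof -
      have "H \<subseteq> G" using that p by (auto simp: factors_def)
      then have adj: "adj_matrix (G - H) = adj_matrix G - adj_matrix H"
        by (auto simp: adj_matrix_def vec_eq_iff)
      have frac: "real (d - a) / real d = 1 - real a / real d"
        using a \<open>d > 0\<close> by (simp add: of_nat_diff diff_divide_distrib)
      show ?thesis unfolding adj frac by (simp add: algebra_simps)
    qed
    have "measure_pmf.prob (map_pmf f p) {(H, M).
         \<bar>u \<bullet> ((adj_matrix H - (real (d - a) / real d) *\<^sub>R adj_matrix G + M) *v v)\<bar>
           > t * s * infnorm u * infnorm v}
      = measure_pmf.prob p {(H, M).
         \<bar>u \<bullet> ((adj_matrix H - (real a / real d) *\<^sub>R adj_matrix G + M) *v v)\<bar>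
           > t * s * infnorm u * infnorm v}"
      unfolding measure_map_pmf
    proof (rule measure_pmf.finite_measure_eq_AE)
      show "AE x in measure_pmf p. x \<in> f -` {(H, M).
         \<bar>u \<bullet> ((adj_matrix H - (real (d - a) / real d) *\<^sub>R adj_matrix G + M) *v v)\<bar>
           > t * s * infnorm u * infnorm v} \<longleftrightarrow> x \<in> {(H, M).
         \<bar>u \<bullet> ((adj_matrix H - (real a / real d) *\<^sub>R adj_matrix G + M) *v v)\<bar>
           > t * s * infnorm u * infnorm v}"
        unfolding AE_measure_pmf_iff
        by (auto simp: f_def eq matrix_vector_mult_uminus simp del: minus_add_distrib minus_diff_eq)
    qed auto
    with tail[OF that] show ?thesis by simp
  qed
  with sub show ?thesis unfolding random_factor_def by blast
qed

text \<open>A union bound for two-stage experiments, with \<open>A\<close> as the bad event of the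
  first stage.\<close>

lemma prob_bind_pmf_le:
  assumes f: "\<And>x. x \<in> set_pmf p \<Longrightarrow> x \<notin> A \<Longrightarrow> measure_pmf.prob (f x) B \<le> e" and e: "e \<ge> 0"
  shows "measure_pmf.prob (bind_pmf p f) B \<le> measure_pmf.prob p A + e"
proof -
  have "emeasure (bind_pmf p f) B = (\<integral>\<^sup>+x. emeasure (f x) B \<partial>measure_pmf p)" by simp
  also have "\<dots> \<le> (\<integral>\<^sup>+x. indicator A x + ennreal e \<partial>measure_pmf p)"
  proof (rule nn_integral_mono_AE, unfold AE_measure_pmf_iff, rule ballI)
    fix x assume "x \<in> set_pmf p"
    show "emeasure (f x) B \<le> indicator A x + ennreal e"
    proof (cases "x \<in> A")
      case True
      have "emeasure (f x) B \<le> 1" by (rule measure_pmf.emeasure_le_1)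
      also have "1 \<le> indicator A x + ennreal e" using True by simp
      finally show ?thesis .
    next
      case False
      then show ?thesis using f[OF \<open>x \<in> set_pmf p\<close>] by (simp add: measure_pmf.emeasure_eq_measure ennreal_leI)
    qed
  qed
  also have "\<dots> = ennreal (measure_pmf.prob p A + e)"
    using e by (simp add: nn_integral_add measure_pmf.emeasure_eq_measure)
  finally show ?thesis using e by (simp add: measure_pmf.emeasure_eq_measure del: ennreal_plus)
qed

text \<open>Choose an \<open>m\<close>-factor of \<open>G\<close>, then an \<open>a\<close>-factor
  of it. The total error is the second error plus \<open>a / m\<close> times the first. The factor
  \<open>a / m\<close> is kept in the norm bound, but only estimated by 1 in the deviation.\<close>

lemma random_factor_compose:
  fixes G :: "'n::finite graph"
  assumes m: "m > 0" "a \<le> m"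
    and first: "random_factor m d G r1 s1 h1"
    and second: "\<And>H. H \<in> factors m G \<Longrightarrow> random_factor a m H r2 s2 h2"
  shows "random_factor a d G (real a / real m * r1 + r2) (s1 + s2) (h1 + h2)"
proof -
  define c where "c = real a / real m"
  have c: "0 \<le> c" "c \<le> 1" using m by (auto simp: c_def)
  define Y where "Y a d (G :: 'n graph) x = (case x of (H, M) \<Rightarrow>
      adj_matrix H - (real a / real d) *\<^sub>R adj_matrix G + M)" for a d G x
  define E where "E a d G s u v t = {x. \<bar>u \<bullet> (Y a d G x *v v)\<bar> > t * s * infnorm u * infnorm v}"
    for a d G s u v and t :: real
  have E: "E a d G s u v t = {(H, M).
      \<bar>u \<bullet> ((adj_matrix H - (real a / real d) *\<^sub>R adj_matrix G + M) *v v)\<bar>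
         > t * s * infnorm u * infnorm v}" for a d G s u v t
    by (auto simp: E_def Y_def)
  obtain p where p: "set_pmf p \<subseteq> factors m G \<times> {M. spectral_norm M \<le> r1}"
    and p_tail: "\<And>u v t. t \<ge> 0 \<Longrightarrow> measure_pmf.prob p (E m d G s1 u v t) \<le> h1 * exp (- t\<^sup>2 / 2)"
    using first unfolding random_factor_def E[symmetric] by blast
  have "\<forall>H. \<exists>q. H \<in> factors m G \<longrightarrow> (set_pmf q \<subseteq> factors a H \<times> {M. spectral_norm M \<le> r2} \<and>
    (\<forall>u v t. t \<ge> 0 \<longrightarrow> measure_pmf.prob q (E a m H s2 u v t) \<le> h2 * exp (- t\<^sup>2 / 2)))"
    using second unfolding random_factor_def E[symmetric] by blast
  then obtain q where q: "\<And>H. H \<in> factors m G \<Longrightarrow> set_pmf (q H) \<subseteq> factors a H \<times> {M. spectral_norm M \<le> r2}"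
    and q_tail: "\<And>H u v t. H \<in> factors m G \<Longrightarrow> t \<ge> 0 \<Longrightarrow>
      measure_pmf.prob (q H) (E a m H s2 u v t) \<le> h2 * exp (- t\<^sup>2 / 2)"
    by metis
  have fst_p: "fst x \<in> factors m G" if "x \<in> set_pmf p" for x using that p by auto
  obtain x0 where "x0 \<in> set_pmf p" using set_pmf_not_empty by fastforce
  \<comment> \<open>Nonnegativity of \<open>h2\<close> is read off from the tail bound at zero
    vectors and \<open>t = 0\<close>, where a probability is at most \<open>h2\<close>.\<close>
  from order_trans[OF measure_nonneg q_tail[OF fst_p[OF this], of 0 0 0]] have h2: "h2 \<ge> 0" by simp
  define g where "g x y = (fst y, snd y + c *\<^sub>R snd x)"
    for x :: "'n graph \<times> (real ^ 'n ^ 'n)" and y :: "'n graph \<times> (real ^ 'n ^ 'n)"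
  define p' where "p' = bind_pmf p (\<lambda>x. map_pmf (g x) (q (fst x)))"
  have "set_pmf p' \<subseteq> factors a G \<times> {M. spectral_norm M \<le> c * r1 + r2}"
  proof
    fix z assume "z \<in> set_pmf p'"
    then obtain x y where x: "x \<in> set_pmf p" and y: "y \<in> set_pmf (q (fst x))" and z: "z = g x y"
      by (auto simp: p'_def)
    have "fst y \<in> factors a (fst x)" "spectral_norm (snd y) \<le> r2"
      using q[OF fst_p[OF x]] y by auto
    moreover have "fst x \<subseteq> G" "spectral_norm (snd x) \<le> r1" using subsetD[OF p x] by (auto simp: factors_def mem_Times_iff)
    moreover have "spectral_norm (snd y + c *\<^sub>R snd x) \<le> spectral_norm (snd y) + c * spectral_norm (snd x)"
      using spectral_norm_add[of "snd y" "c *\<^sub>R snd x"] spectral_norm_scaleR[of c "snd x"] c by simp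
    moreover have "c * spectral_norm (snd x) \<le> c * r1" using calculation(4) c by (intro mult_left_mono)
    ultimately show "z \<in> factors a G \<times> {M. spectral_norm M \<le> c * r1 + r2}"
      by (auto simp: z g_def factors_def)
  qed
  moreover have "measure_pmf.prob p' (E a d G (s1 + s2) u v t) \<le> (h1 + h2) * exp (- t\<^sup>2 / 2)"
    if t: "t \<ge> 0" for u v t
  proof -
    have "measure_pmf.prob p' (E a d G (s1 + s2) u v t)
      \<le> measure_pmf.prob p (E m d G s1 u v t) + h2 * exp (- t\<^sup>2 / 2)"
      unfolding p'_def
    proof (rule prob_bind_pmf_le)
      fix x assume x: "x \<in> set_pmf p" "x \<notin> E m d G s1 u v t"
      have "g x -` E a d G (s1 + s2) u v t \<subseteq> E a m (fst x) s2 u v t"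
      proof
        fix y assume y: "y \<in> g x -` E a d G (s1 + s2) u v t"
        \<comment> \<open>The multiples of the adjacency matrix of \<open>fst x\<close> cancel, and
          \<open>(a / m) * (m / d) = a / d\<close>.\<close>
        have "Y a d G (g x y) = Y a m (fst x) y + c *\<^sub>R Y m d G x"
          using m by (auto simp: Y_def g_def c_def case_prod_beta algebra_simps)
        then have "u \<bullet> (Y a d G (g x y) *v v) = u \<bullet> (Y a m (fst x) y *v v) + c * (u \<bullet> (Y m d G x *v v))"
          by (simp add: matrix_vector_mult_add_rdistrib scaleR_matrix_vector_assoc[symmetric] inner_add_right)
        then have "\<bar>u \<bullet> (Y a d G (g x y) *v v)\<bar>
            \<le> \<bar>u \<bullet> (Y a m (fst x) y *v v)\<bar> + \<bar>c * (u \<bullet> (Y m d G x *v v))\<bar>" by simp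
        also have "\<bar>c * (u \<bullet> (Y m d G x *v v))\<bar> \<le> \<bar>u \<bullet> (Y m d G x *v v)\<bar>"
          using c by (simp add: abs_mult mult_left_le_one_le)
        also have "\<dots> \<le> t * s1 * infnorm u * infnorm v" using x(2) by (simp add: E_def)
        finally show "y \<in> E a m (fst x) s2 u v t"
          using y by (simp add: E_def algebra_simps)
      qed
      then have "measure_pmf.prob (map_pmf (g x) (q (fst x))) (E a d G (s1 + s2) u v t)
        \<le> measure_pmf.prob (q (fst x)) (E a m (fst x) s2 u v t)"
        unfolding measure_map_pmf by (intro measure_pmf.finite_measure_mono) auto
      also have "\<dots> \<le> h2 * exp (- t\<^sup>2 / 2)" by (rule q_tail[OF fst_p[OF x(1)] t])
      finally show "measure_pmf.prob (map_pmf (g x) (q (fst x))) (E a d G (s1 + s2) u v t)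
        \<le> h2 * exp (- t\<^sup>2 / 2)" .
    qed (use h2 in simp)
    also have "\<dots> \<le> h1 * exp (- t\<^sup>2 / 2) + h2 * exp (- t\<^sup>2 / 2)" using p_tail[OF t] by simp
    finally show ?thesis by (simp add: algebra_simps)
  qed
  ultimately show ?thesis unfolding random_factor_def E[symmetric] c_def[symmetric] by blast
qed

section \<open>Deleting a perfect matching and halving the degree\<close>

context bipartite_graph
begin

lemma simple_graph: "simple_graph R"
  using sym irr by (simp add: simple_graph_def)

text \<open>The constant weight \<open>1 / d\<close> on the edges is a fractional perfect matching,
  which rounds to an integral one. Both matrices have norm at most 1, so \<open>M\<close> can hold
  the whole error; then pass to the complement.\<close>

lemma random_factor_delete_matching:
  assumes reg: "regular d R" and d: "d > 0"
  shows "random_factor (d - 1) d R 2 0 0"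
proof -
  have deg: "(\<Sum>y\<in>UNIV. adj_matrix R $ x $ y) = d" for x
    using reg by (simp add: regular_def flip: vertex_degree_sum)
  have "\<exists>H\<subseteq>R. Relation.sym H \<and>
      (\<forall>x. real (vertex_degree H x) = (\<Sum>y\<in>UNIV. adj_matrix R $ x $ y / d))"
  proof (rule integral_rounding)
    show "(\<Sum>y\<in>UNIV. adj_matrix R $ x $ y / d) \<in> \<int>" for x
      using d by (simp add: deg flip: sum_divide_distrib)
  qed (use d symE in \<open>auto simp: adj_matrix_def\<close>)
  then obtain H where H: "H \<subseteq> R" "Relation.sym H" "\<And>x. vertex_degree H x = 1"
    using d by (auto simp: deg simp flip: sum_divide_distrib)
  then have HF: "H \<in> factors 1 R"
    using irr by (auto simp: factors_def simple_graph_def regular_def irrefl_def)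
  have "spectral_norm ((1 / real d) *\<^sub>R adj_matrix R - adj_matrix H)
      \<le> spectral_norm ((1 / real d) *\<^sub>R adj_matrix R) + spectral_norm ((- 1) *\<^sub>R adj_matrix H)"
    using spectral_norm_add[of "(1 / real d) *\<^sub>R adj_matrix R" "(- 1) *\<^sub>R adj_matrix H"] by simp
  also have "\<dots> \<le> \<bar>1 / real d\<bar> * spectral_norm (adj_matrix R) + \<bar>- 1\<bar> * spectral_norm (adj_matrix H)"
    by (intro add_mono spectral_norm_scaleR)
  also have "\<dots> \<le> \<bar>1 / real d\<bar> * real d + \<bar>- 1\<bar> * real 1"
    using H reg sym by (intro add_mono mult_left_mono spectral_norm_adj_regular) (auto simp: regular_def)
  also have "\<dots> = 2" using d by simp
  finally have "random_factor 1 d R 2 0 0" using random_factor_const[OF HF, of d 2] by simp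
  then show ?thesis using random_factor_complement[OF simple_graph reg d, of 1] d by simp
qed

text \<open>The factor consists of the positive edges of the random signing \<open>S\<close> and a
  fixed half \<open>H0\<close> of the remainder. With \<open>T\<close> the signing of
  \<open>R0\<close> that is positive on \<open>H0\<close>, its adjacency matrix is half of
  \<open>adj_matrix R + S + T\<close>. So \<open>M = - T / 2\<close> leaves exactly the error
  \<open>S / 2\<close>.\<close>

lemma random_factor_half:
  assumes reg: "regular (2 * m) R" and m: "m > 0" and k: "CARD('n) \<le> 2 ^ k" "k > 0"
  shows "random_factor m (2 * m) R (sqrt 2 * sqrt (2 * m)) (sqrt (2 * m * CARD('n) * k)) 2"
proof -
  obtain R0 and q :: "(real ^ 'n ^ 'n) pmf" where
    Rq: "R0 \<subseteq> R \<and> Relation.sym R0 \<and> short_cycle_free k R0 \<and>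
      (\<forall>S\<in>set_pmf q. balanced_signing (R - R0) S) \<and>
      (\<forall>u v. (\<integral>\<^sup>+S. ennreal (exp (u \<bullet> (S *v v))) \<partial>measure_pmf q)
       \<le> ennreal (exp (2 * k * card (R - R0) * (infnorm u * infnorm v)\<^sup>2)))"
    using random_short_cycle_signing[OF bipartite_graph_axioms, of k] by (elim exE)
  then have R0: "R0 \<subseteq> R" "Relation.sym R0" "short_cycle_free k R0"
    and q: "\<And>S. S \<in> set_pmf q \<Longrightarrow> balanced_signing (R - R0) S"
    and mgf: "\<And>u v. (\<integral>\<^sup>+S. ennreal (exp (u \<bullet> (S *v v))) \<partial>measure_pmf q)
       \<le> ennreal (exp (2 * k * card (R - R0) * (infnorm u * infnorm v)\<^sup>2))"
    by blast+
  interpret R0: bipartite_graph X R0 by (rule subgraph[OF R0(1,2)])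
  have deg: "(\<Sum>y\<in>UNIV. adj_matrix R $ x $ y) = 2 * m" for x
    using reg by (simp add: regular_def flip: vertex_degree_sum)
  obtain S0 where "S0 \<in> set_pmf q" using set_pmf_not_empty by fastforce
  from q[OF this] have S0: "\<bar>S0 $ x $ y\<bar> = of_bool ((x, y) \<in> R - R0)"
    "(\<Sum>y\<in>UNIV. S0 $ x $ y) = 0" for x y
    by (auto simp: balanced_signing_def)
  \<comment> \<open>One arbitrary signing suffices to see that the degrees of \<open>R0\<close> are
    even: half of each is \<open>m\<close> minus a number of positive edges.\<close>
  have half_deg: "(\<Sum>y\<in>UNIV. adj_matrix R0 $ x $ y / 2) = real m - (\<Sum>y\<in>UNIV. of_bool (S0 $ x $ y = 1))" for x
  proof -
    have "adj_matrix R0 $ x $ y / 2 = adj_matrix R $ x $ y / 2 + S0 $ x $ y / 2 - of_bool (S0 $ x $ y = 1)" for y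
      using S0(1)[of x y] R0(1)
      by (cases "(x, y) \<in> R"; cases "(x, y) \<in> R0") (auto simp: adj_matrix_def abs_if split: if_splits)
    then show ?thesis
      by (simp add: sum.distrib sum_subtractf deg S0(2) flip: sum_divide_distrib)
  qed
  have "\<exists>H\<subseteq>R0. Relation.sym H \<and>
      (\<forall>x. real (vertex_degree H x) = (\<Sum>y\<in>UNIV. adj_matrix R0 $ x $ y / 2))"
  proof (rule R0.integral_rounding)
    show "(\<Sum>y\<in>UNIV. adj_matrix R0 $ x $ y / 2) \<in> \<int>" for x
      unfolding half_deg by (intro Ints_diff Ints_sum) (auto simp: of_bool_def)
  qed (use R0.symE in \<open>auto simp: adj_matrix_def\<close>)
  then obtain H0 where H0: "H0 \<subseteq> R0" "Relation.sym H0"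
    "\<And>x. (\<Sum>y\<in>UNIV. adj_matrix H0 $ x $ y) = (\<Sum>y\<in>UNIV. adj_matrix R0 $ x $ y / 2)"
    by (auto simp: vertex_degree_sum)
  define T where "T = 2 *\<^sub>R adj_matrix H0 - adj_matrix R0"
  define M where "M = (- 1 / 2) *\<^sub>R T"
  define H where "H S = H0 \<union> {(x, y). S $ x $ y = 1}" for S :: "real ^ 'n ^ 'n"
  have adj: "adj_matrix (H S) = (1 / 2) *\<^sub>R (adj_matrix R + S + T)" if "S \<in> set_pmf q" for S
  proof -
    have "adj_matrix (H S) $ x $ y = ((1 / 2) *\<^sub>R (adj_matrix R + S + T)) $ x $ y" for x y
    proof -
      have "\<bar>S $ x $ y\<bar> = of_bool ((x, y) \<in> R - R0)" using q[OF that] by (simp add: balanced_signing_def)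
      then show ?thesis using H0(1) R0(1)
        by (cases "(x, y) \<in> R"; cases "(x, y) \<in> R0")
          (auto simp: adj_matrix_def H_def T_def abs_if split: if_splits)
    qed
    then show ?thesis by (simp add: vec_eq_iff)
  qed
  have HF: "H S \<in> factors m R" if S: "S \<in> set_pmf q" for S
  proof -
    have S': "S $ x $ y = S $ y $ x" "\<bar>S $ x $ y\<bar> = of_bool ((x, y) \<in> R - R0)"
      "(\<Sum>y\<in>UNIV. S $ x $ y) = 0" for x y
      using q[OF S] by (auto simp: balanced_signing_def)
    have "(x, y) \<in> R" if "S $ x $ y = 1" for x y using S'(2)[of x y] that by (auto split: if_splits)
    then have "H S \<subseteq> R" using H0(1) R0(1) by (auto simp: H_def)
    moreover have "Relation.sym (H S)" using H0(2) S'(1) by (auto simp: H_def sym_def)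
    moreover have "real (vertex_degree (H S) x) = m" for x
      by (simp add: vertex_degree_sum adj[OF S] T_def sum.distrib sum_subtractf deg S'(3) H0(3)
          flip: sum_divide_distrib sum_distrib_left)
    ultimately show ?thesis
      using irr by (auto simp: factors_def simple_graph_def regular_def irrefl_def)
  qed
  have "spectral_norm M \<le> \<bar>- 1 / 2\<bar> * spectral_norm T"
    unfolding M_def by (rule spectral_norm_scaleR)
  \<comment> \<open>The entries of \<open>T\<close> are signs on the edges of \<open>R0\<close>,
    which has no short cycles.\<close>
  also have "spectral_norm T \<le> spectral_norm (adj_matrix R0)"
    using H0(1) by (intro spectral_norm_dominated) (auto simp: T_def adj_matrix_def)
  also have "spectral_norm (adj_matrix R0) \<le> sqrt (8 * real (2 * m))"
  proof (intro spectral_norm_le R0.norm_adj_matrix_short_free[OF R0(3) _ k])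
    show "vertex_degree R0 x \<le> 2 * m" for x
    proof -
      have "vertex_degree R0 x \<le> vertex_degree R x"
        unfolding vertex_degree_def using R0(1) by (intro card_mono) auto
      then show ?thesis using reg by (simp add: regular_def)
    qed
  qed
  also have "sqrt (8 * real (2 * m)) = 2 * sqrt 2 * sqrt (2 * m)"
  proof -
    have "sqrt 8 = 2 * sqrt 2" using real_sqrt_mult[of 4 2] by simp
    then show ?thesis by (simp only: real_sqrt_mult[of 8])
  qed
  finally have normM: "spectral_norm M \<le> sqrt 2 * sqrt (2 * m)" by simp
  let ?s = "sqrt (2 * m * CARD('n) * k)"
  have "measure_pmf.prob (map_pmf (\<lambda>S. (H S, M)) q) {(H, M).
      \<bar>u \<bullet> ((adj_matrix H - (real m / real (2 * m)) *\<^sub>R adj_matrix R + M) *v v)\<bar>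
        > t * ?s * infnorm u * infnorm v} \<le> 2 * exp (- t\<^sup>2 / 2)" if t: "t \<ge> 0" for u v t
  \<comment> \<open>For a zero vector the variance proxy \<open>V\<close> would vanish; the event is
    then empty.\<close>
  proof (cases "u = 0 \<or> v = 0")
    case True
    then show ?thesis by (auto simp: infnorm_0)
  next
    case False
    define c where "c = infnorm u * infnorm v"
    have c: "c > 0" using False by (simp add: c_def infnorm_pos_lt)
    \<comment> \<open>This is twice the coefficient of \<open>l^2\<close> in the moment bound, with
      the number of removed pairs bounded by \<open>2 * m * CARD('n)\<close>. It satisfies
      \<open>(2 * t * ?s * c)^2 = t^2 * V\<close>, where the 2 stems from the error being
      \<open>S / 2\<close>.\<close>
    define V where "V = 4 * k * (2 * m * CARD('n)) * c\<^sup>2"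
    have V: "V > 0" using c m k(2) by (simp add: V_def)
    have "measure_pmf.prob (map_pmf (\<lambda>S. (H S, M)) q) {(H, M).
      \<bar>u \<bullet> ((adj_matrix H - (real m / real (2 * m)) *\<^sub>R adj_matrix R + M) *v v)\<bar>
        > t * ?s * infnorm u * infnorm v} = measure_pmf.prob q {S. \<bar>u \<bullet> (S *v v)\<bar> > 2 * t * ?s * c}"
      unfolding measure_map_pmf
    proof (rule measure_pmf.finite_measure_eq_AE)
      have "adj_matrix (H S) - (real m / real (2 * m)) *\<^sub>R adj_matrix R + M = (1 / 2) *\<^sub>R S"
        if "S \<in> set_pmf q" for S
        using m by (simp add: adj[OF that] M_def algebra_simps)
      then show "AE S in measure_pmf q. S \<in> (\<lambda>S. (H S, M)) -` {(H, M).
      \<bar>u \<bullet> ((adj_matrix H - (real m / real (2 * m)) *\<^sub>R adj_matrix R + M) *v v)\<bar>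
        > t * ?s * infnorm u * infnorm v} \<longleftrightarrow> S \<in> {S. \<bar>u \<bullet> (S *v v)\<bar> > 2 * t * ?s * c}"
        unfolding AE_measure_pmf_iff
        by (auto simp: c_def abs_mult mult.assoc scaleR_matrix_vector_assoc[symmetric] simp del: scaleR_half_double)
    qed auto
    also have "\<dots> \<le> 2 * exp (- (2 * t * ?s * c)\<^sup>2 / (2 * V))"
    proof (rule subgaussian_tail[OF _ V])
      fix l
      have "(\<integral>\<^sup>+S. ennreal (exp (l * (u \<bullet> (S *v v)))) \<partial>measure_pmf q)
        \<le> ennreal (exp (2 * k * card (R - R0) * (infnorm (l *\<^sub>R u) * infnorm v)\<^sup>2))"
        using mgf[of "l *\<^sub>R u" v] by simp
      also have "(infnorm (l *\<^sub>R u) * infnorm v)\<^sup>2 = l\<^sup>2 * c\<^sup>2"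
        by (simp add: infnorm_mul c_def power_mult_distrib)
      also have "2 * k * card (R - R0) * (l\<^sup>2 * c\<^sup>2) \<le> 2 * k * (2 * m * CARD('n)) * (l\<^sup>2 * c\<^sup>2)"
      proof -
        have "card (R - R0) \<le> 2 * m * CARD('n)"
          using card_mono[of R "R - R0"] card_regular[OF reg] by auto
        then show ?thesis by (intro mult_right_mono mult_left_mono) (simp_all only: of_nat_le_iff mult_le_mono2 of_nat_0_le_iff zero_le_mult_iff zero_le_power2 simp_thms)
      qed
      also have "\<dots> = l\<^sup>2 * V / 2" by (simp add: V_def)
      finally show "(\<integral>\<^sup>+S. ennreal (exp (l * (u \<bullet> (S *v v)))) \<partial>measure_pmf q) \<le> ennreal (exp (l\<^sup>2 * V / 2))"
        by simp
    qed (use t c in auto)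
    also have "(2 * t * ?s * c)\<^sup>2 = t\<^sup>2 * V" by (simp add: V_def power_mult_distrib)
    also have "- (t\<^sup>2 * V) / (2 * V) = - t\<^sup>2 / 2" using V by simp
    finally show ?thesis .
  qed
  then show ?thesis
    unfolding random_factor_def
    by (intro exI[of _ "map_pmf (\<lambda>S. (H S, M)) q"] conjI) (use HF normM in auto)
qed

end

text \<open>
  The constants solve the recursion along \<open>d \<mapsto> d div 2\<close>: halving an even degree \<open>d\<close> costs
  \<open>\<surd>2\<cdot>\<surd>d\<close> in norm and \<open>\<surd>(d n k)\<close> in deviation, and \<open>2 + \<surd>2\<close> is the sum of the geometric series
  with ratio \<open>1/\<surd>2\<close>. Deleting a matching before halving costs at most \<open>1\<close> in norm, which
  is the summand \<open>log 2 d\<close>.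
\<close>

lemma random_factor_exists:
  assumes "bipartite_graph X (G :: 'n::finite graph)" "regular d G" "d > 0" "a \<le> d"
    and k: "CARD('n) \<le> 2 ^ k" "k > 0"
  shows "random_factor a d G ((2 + 2 * sqrt 2) * sqrt d + log 2 d)
    ((2 + sqrt 2) * sqrt (d * CARD('n) * k)) (2 * log 2 d)"
  using assms(1-4)
proof (induction d arbitrary: a G rule: less_induct)
  case (less d)
  let ?r = "\<lambda>d. (2 + 2 * sqrt 2) * sqrt (real d) + log 2 (real d)"
  let ?s = "\<lambda>d. (2 + sqrt 2) * sqrt (d * CARD('n) * k)"
  let ?h = "\<lambda>d. 2 * log 2 (real d)"
  interpret G: bipartite_graph X G by fact
  have small: "random_factor a d G (?r d) (?s d) (?h d)" if a: "2 * a \<le> d" for a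
  proof (cases "a = 0")
    case True
    have "{} \<in> factors 0 G"
      by (auto simp: factors_def simple_graph_def regular_def vertex_degree_def irrefl_def sym_def)
    moreover have "spectral_norm ((real 0 / real d) *\<^sub>R adj_matrix G - adj_matrix {}) \<le> 0"
      by (intro spectral_norm_le) (simp add: adj_matrix_def matrix_vector_mult_def norm_eq_zero vec_eq_iff)
    ultimately have "random_factor 0 d G 0 0 0" by (rule random_factor_const)
    then show ?thesis
      unfolding True
      by (rule random_factor_mono) (use less.prems(3) in \<open>auto intro!: add_nonneg_nonneg\<close>)
  next
    case False
    define m where "m = d div 2"
    have m: "m > 0" "a \<le> m" "m < d" using False a by (auto simp: m_def)
    \<comment> \<open>The logarithm drops by 1 when \<open>2 * m\<close> is halved. In the even case
      this unit is not spent; it is saved to pay for a deleted matching.\<close>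
    have even_case: "random_factor a (2 * m) H (?r (2 * m) - 1) (?s (2 * m)) (?h (2 * m))"
      if H: "bipartite_graph X H" "regular (2 * m) H" for H
    proof -
      interpret H: bipartite_graph X H by fact
      have "random_factor a m F (?r m) (?s m) (?h m)" if "F \<in> factors m H" for F
        using that m H.subgraph[of F] by (intro less.IH) (auto simp: factors_def simple_graph_def)
      then have rf: "random_factor a (2 * m) H (a / m * (sqrt 2 * sqrt (2 * m)) + ?r m)
          (sqrt (2 * m * CARD('n) * k) + ?s m) (2 + ?h m)"
        using m by (intro random_factor_compose[OF _ _ H.random_factor_half] H k)
      show ?thesis
      proof (rule random_factor_mono[OF rf])
        have log: "log 2 (real (2 * m)) = 1 + log 2 (real m)" using m by (simp add: log_mult)
        have "a / m * (sqrt 2 * sqrt (2 * m)) \<le> sqrt 2 * sqrt (2 * m)"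
          using m by (intro mult_left_le_one_le) auto
        then show "a / m * (sqrt 2 * sqrt (2 * m)) + ?r m \<le> ?r (2 * m) - 1"
          unfolding log by (simp add: real_sqrt_mult algebra_simps)
        show "2 + ?h m \<le> ?h (2 * m)" unfolding log by simp
        show "sqrt (2 * m * CARD('n) * k) + ?s m \<le> ?s (2 * m)"
          by (simp add: real_sqrt_mult algebra_simps)
      qed
    qed
    show ?thesis
    proof (cases "even d")
      case True
      then have "d = 2 * m" by (simp add: m_def)
      then show ?thesis
        using even_case[OF less.prems(1)] less.prems(2) by (auto intro: random_factor_mono)
    next
      case False
      then have d: "d = 2 * m + 1" by (simp add: m_def)
      have "random_factor (2 * m) d G 2 0 0"
        using G.random_factor_delete_matching[OF less.prems(2,3)] d by simp
      moreover have "random_factor a (2 * m) H (?r (2 * m) - 1) (?s (2 * m)) (?h (2 * m))"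
        if "H \<in> factors (2 * m) G" for H
        using that G.subgraph[of H] by (intro even_case) (auto simp: factors_def simple_graph_def)
      ultimately have "random_factor a d G (a / real (2 * m) * 2 + (?r (2 * m) - 1))
          (0 + ?s (2 * m)) (0 + ?h (2 * m))"
        using m by (intro random_factor_compose) auto
      then show ?thesis
      proof (rule random_factor_mono)
        \<comment> \<open>The matching costs 2 in norm, but composition scales this by
          \<open>a / (2 * m)\<close>, which is at most one half since
          \<open>a \<le> m\<close>.\<close>
        have "a / real (2 * m) * 2 \<le> 1" using m by simp
        moreover have "sqrt (real (2 * m)) \<le> sqrt (real d)" using d by simp
        moreover have log: "log 2 (real (2 * m)) \<le> log 2 (real d)" using d m by simp
        ultimately show "a / real (2 * m) * 2 + (?r (2 * m) - 1) \<le> ?r d"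
          using mult_left_mono[of "sqrt (real (2 * m))" "sqrt (real d)" "2 + 2 * sqrt 2"] by simp
        show "0 + ?h (2 * m) \<le> ?h d" using log by simp
        have "sqrt (real (2 * m * CARD('n) * k)) \<le> sqrt (real (d * CARD('n) * k))"
          using d by (intro real_sqrt_le_mono of_nat_mono mult_le_mono1) simp
        then have "?s (2 * m) \<le> ?s d" by (rule mult_left_mono) simp
        then show "0 + ?s (2 * m) \<le> ?s d" by simp
      qed
    qed
  qed
  show ?case
  proof (cases "2 * a \<le> d")
    case False
    \<comment> \<open>When \<open>2 * a > d\<close>, the complementary degree \<open>d - a\<close>
      is at most half of \<open>d\<close>.\<close>
    then have "random_factor (d - a) d G (?r d) (?s d) (?h d)" by (intro small) auto
    from random_factor_complement[OF G.simple_graph less.prems(2,3) _ this] show ?thesis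
      using less.prems(4) by simp
  qed (rule small)
qed

text \<open>The inequality \<open>ln y \<le> y / e\<close> at \<open>y = sqrt x\<close> gives the
  constant \<open>2 / (e * ln 2)\<close>, about 1.06. The constant \<open>4 - 2 * sqrt 2\<close>,
  about 1.17, is what 6 leaves beside \<open>2 + 2 * sqrt 2\<close>.\<close>

lemma log2_le_sqrt:
  assumes "x > 0"
  shows "log 2 x \<le> (4 - 2 * sqrt 2) * sqrt x"
proof -
  \<comment> \<open>The exponent 12 suffices: \<open>(1 + 1/12)^12\<close> is about 2.61.\<close>
  have e: "2.6 \<le> exp (1 :: real)"
    using exp_ge_one_plus_x_over_n_power_n[of 12 1] by (simp add: power_divide)
  have "ln (sqrt x / exp 1) \<le> sqrt x / exp 1 - 1" using assms by (intro ln_le_minus_one) simp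
  then have "ln x \<le> 2 * (sqrt x / exp 1)" using assms by (simp add: ln_div ln_sqrt mult.commute)
  then have "log 2 x \<le> 2 * (sqrt x / exp 1) / ln 2" unfolding log_def by (intro divide_right_mono) auto
  also have "\<dots> = 2 / (exp 1 * ln 2) * sqrt x" by simp
  also have "\<dots> \<le> (4 - 2 * sqrt 2) * sqrt x"
  proof (intro mult_right_mono)
    have "sqrt 2 \<le> 1.415" by (rule real_le_lsqrt) (auto simp: power2_eq_square)
    then have "2 / (2.6 * (2 / 3)) \<le> 4 - 2 * sqrt 2" by simp
    moreover have "2 / (exp 1 * ln 2) \<le> 2 / (2.6 * (2 / 3 :: real))"
      using e ln2_ge_two_thirds by (intro divide_left_mono mult_mono mult_pos_pos) auto
    ultimately show "2 / (exp 1 * ln 2) \<le> 4 - 2 * sqrt 2" by linarith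
  qed (use assms in simp)
  finally show ?thesis .
qed

theorem proposition2p4:
  fixes a d :: nat
    and G :: "'n::finite graph"
  assumes "d > 0" and "0 \<le> a" and "a \<le> d"
    and "simple_graph G" and "bipartite G" and "regular d G"
  shows "\<exists>N :: ('n graph \<times> (real ^ 'n ^ 'n)) measure.
    prob_space N \<and> sets N = sets (factor_matrix_space a G (6 * sqrt (real d))) \<and>
    (\<forall>(u :: real ^ 'n) (v :: real ^ 'n) (t :: real). t \<ge> 0 \<longrightarrow>
      \<P>((H, M) in N.
          \<bar>u \<bullet> ((adj_matrix H - (real a / real d) *\<^sub>R adj_matrix G + M) *v v)\<bar>
            > t * (2 + sqrt 2) * sqrt (real d * real CARD('n) * of_int \<lceil>log 2 (real CARD('n))\<rceil>)
                * infnorm u * infnorm v)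
        \<le> 2 * log 2 (real d) * exp (- t\<^sup>2 / 2))"
proof -
  obtain X where X: "\<forall>(x, y) \<in> G. x \<in> X \<longleftrightarrow> y \<notin> X" using assms(5) unfolding bipartite_def by blast
  interpret bipartite_graph X G
    by unfold_locales (use X assms(4) in \<open>auto simp: simple_graph_def\<close>)
  define n where "n = CARD('n)"
  define k where "k = nat \<lceil>log 2 (real n)\<rceil>"
  \<comment> \<open>As \<open>d > 0\<close> there is an edge, hence two distinct vertices; this
    makes \<open>k\<close> positive.\<close>
  have "n \<ge> 2"
  proof -
    fix x :: 'n
    have "{y. (x, y) \<in> G} \<noteq> {}"
      using assms(1,6) by (metis card.empty less_irrefl regular_def vertex_degree_def)
    then obtain y where "(x, y) \<in> G" by blast
    then have "x \<noteq> y" using irr by (auto simp: irrefl_def)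
    then show ?thesis unfolding n_def using card_mono[of UNIV "{x, y}"] by simp
  qed
  then have log: "log 2 (real n) \<ge> 1" by simp
  then have k: "real k = of_int \<lceil>log 2 (real n)\<rceil>" "k > 0" unfolding k_def by linarith+
  have "n \<le> 2 ^ k"
  proof -
    have "real n = 2 powr log 2 (real n)" using \<open>n \<ge> 2\<close> by simp
    also have "\<dots> \<le> 2 powr real k" unfolding k(1) by (intro powr_mono) auto
    also have "\<dots> = real (2 ^ k)" by (simp add: powr_realpow)
    finally show ?thesis by (simp only: of_nat_le_iff)
  qed
  then have "random_factor a d G ((2 + 2 * sqrt 2) * sqrt d + log 2 d)
      ((2 + sqrt 2) * sqrt (d * CARD('n) * k)) (2 * log 2 d)"
    using assms k(2) bipartite_graph_axioms by (intro random_factor_exists) (auto simp: n_def)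
  then have "random_factor a d G (6 * sqrt d) ((2 + sqrt 2) * sqrt (d * CARD('n) * k)) (2 * log 2 d)"
    by (rule random_factor_mono) (use log2_le_sqrt[of d] assms(1) in \<open>auto simp: algebra_simps\<close>)
  then obtain p where p: "set_pmf p \<subseteq> factors a G \<times> {M. spectral_norm M \<le> 6 * sqrt d}"
    and tail: "\<And>u v t. t \<ge> 0 \<Longrightarrow> measure_pmf.prob p {(H, M).
       \<bar>u \<bullet> ((adj_matrix H - (real a / real d) *\<^sub>R adj_matrix G + M) *v v)\<bar>
         > t * ((2 + sqrt 2) * sqrt (d * CARD('n) * k)) * infnorm u * infnorm v}
       \<le> 2 * log 2 d * exp (- t\<^sup>2 / 2)"
    unfolding random_factor_def by blast
  let ?S = "factor_matrix_space a G (6 * sqrt d)"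
  obtain x0 where x0: "x0 \<in> set_pmf p" using set_pmf_not_empty by fastforce
  \<comment> \<open>Points outside the target space carry no mass; sending them to \<open>x0\<close>
    makes \<open>f\<close> a map into that space without changing the distribution.\<close>
  define f where "f x = (if x \<in> space ?S then x else x0)" for x
  have f: "f \<in> measurable (measure_pmf p) ?S"
    using x0 p by (auto simp: f_def space_factor_matrix_space)
  have f_id: "f x = x" if "x \<in> set_pmf p" for x
    using that p by (auto simp: f_def space_factor_matrix_space)
  define N where "N = distr (measure_pmf p) ?S f"
  have sets_N: "sets N = sets ?S" by (simp add: N_def)
  have "\<P>((H, M) in N. \<bar>u \<bullet> ((adj_matrix H - (real a / real d) *\<^sub>R adj_matrix G + M) *v v)\<bar>
      > t * (2 + sqrt 2) * sqrt (real d * real CARD('n) * of_int \<lceil>log 2 (real CARD('n))\<rceil>)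
          * infnorm u * infnorm v) \<le> 2 * log 2 (real d) * exp (- t\<^sup>2 / 2)" (is "measure N ?E \<le> _")
    if t: "t \<ge> 0" for u v t
  proof -
    let ?t = "t * (2 + sqrt 2) * sqrt (real d * real CARD('n) * of_int \<lceil>log 2 (real CARD('n))\<rceil>)
      * infnorm u * infnorm v"
    have "?E = {x \<in> space N. case x of (H, M) \<Rightarrow>
        \<bar>u \<bullet> ((adj_matrix H - (real a / real d) *\<^sub>R adj_matrix G + M) *v v)\<bar> > ?t}"
      by auto
    also have "\<dots> \<in> sets N" by (rule bilinear_event_measurable[OF sets_N])
    finally have "?E \<in> sets N" .
    then have "measure N ?E = measure_pmf.prob p (f -` ?E)"
      using f by (simp add: N_def measure_distr)
    also have "\<dots> = measure_pmf.prob p (f -` ?E \<inter> set_pmf p)" by (simp add: measure_Int_set_pmf)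
    also have "\<dots> \<le> measure_pmf.prob p {(H, M).
       \<bar>u \<bullet> ((adj_matrix H - (real a / real d) *\<^sub>R adj_matrix G + M) *v v)\<bar>
         > t * ((2 + sqrt 2) * sqrt (d * CARD('n) * k)) * infnorm u * infnorm v}"
      by (rule measure_pmf.finite_measure_mono) (auto simp: f_id k(1) n_def mult.assoc)
    also have "\<dots> \<le> 2 * log 2 d * exp (- t\<^sup>2 / 2)" by (rule tail[OF t])
    finally show ?thesis .
  qed
  moreover have "prob_space N" unfolding N_def by (rule measure_pmf.prob_space_distr[OF f])
  ultimately show ?thesis using sets_N by blast
qed

end
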